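(* The following are equivalent: (i) each $F_i$ ($i\in I$) acts freely on $X_i$; (ii) $\mathcal U(\mathbf F)=\mathcal U_\Delta^\lambda(\mathbf F)$ acts freely on (the set of chambers of) $\Delta$; (iii) $\mathcal U(\mathbf F)$ is a discrete topological group.
   Context: Buildings. Let $I$ be a finite set and $M=(m_{ij})_{i,j\in I}$ a right-angled Coxeter matrix: $m_{ii}=1$ and $m_{ij}=m_{ji}\in\{2,\infty\}$ for $i\ne j$; let $W$ be the Coxeter group with generators $(s_i)_{i\in I}$. A (right-angled) building $\Delta$ of type $M$ is viewed as a chamber system: a set of chambers with an equivalence relation $\sim_i$ ($i$-adjacency) for each $i\in I$, all classes having at least two elements, and a map $\delta:\Delta\times\Delta\to W$ such that for each reduced word $s_{i_1}\cdots s_{i_k}$, $\delta(c,d)=s_{i_1}\cdots s_{i_k}$ iff there is a gallery $c=c_0\sim_{i_1}c_1\sim_{i_2}\cdots\sim_{i_k}c_k=d$ (consecutive chambers distinct) of type $(i_1,\dots,i_k)$. An $i$-panel is an equivalence class of $\sim_i$; $\mathrm{Res}_i(\Delta)$ is the set of $i$-panels. $\mathrm{Aut}(\Delta)$ is the group of bijections of the chamber set preserving each $\sim_i$. $\Delta$ is semiregular with parameters $(q_i)_{i\in I}$ if every $i$-panel has the same (possibly infinite) cardinality $q_i\ge 2$; for any choice of cardinals $q_i\geq 2$ such a building exists and is unique up to isomorphism. Universal groups. For each $i\in I$ let $X_i$ be a set (of $i$-colours) with $|X_i|\ge 2$ and $F_i\le\mathrm{Sym}(X_i)$ an arbitrary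 permutation group (not necessarily transitive or of finite degree); write $\mathbf F=(F_i)_{i\in I}$. Let $\Delta$ be the semiregular right-angled building of type $M$ with $q_i=|X_i|$. A legal colouring is a map $\lambda=(\lambda_i)_{i\in I}:\Delta\to\prod_{i\in I}X_i$ such that for every $i\in I$ and every $i$-panel $\mathcal P$, $\lambda_i|_{\mathcal P}:\mathcal P\to X_i$ is a bijection and $\lambda_j|_{\mathcal P}$ is constant for all $j\ne i$. Fix a legal colouring $\lambda$. The local action of $g\in\mathrm{Aut}(\Delta)$ at an $i$-panel $\mathcal P$ is $\sigma_\lambda(g,\mathcal P)=\lambda_i|_{g\mathcal P}\circ g|_{\mathcal P}\circ(\lambda_i|_{\mathcal P})^{-1}\in\mathrm{Sym}(X_i)$. The universal group is $\mathcal U_\Delta^\lambda(\mathbf F)=\{g\in\mathrm{Aut}(\Delta)\mid \sigma_\lambda(g,\mathcal P)\in F_i\text{ for all }i\in I,\ \mathcal P\in\mathrm{Res}_i(\Delta)\}$. Topology. $\mathcal U_\Delta^\lambda(\mathbf F)$ carries the permutation topology for its action on the set of chambers: the pointwise stabilisers of finite sets of chambers form a neighbourhood basis of the identity. An action is free if all point stabilisers are trivial.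
   Formalization: (iii) ⇒ (i) is proved only when every i in I has some j with m_ij = ∞; without this it fails: for I={i}, |X_i|=3, F_i=Sym(3), U(F)=Sym(3) is discrete but F_i is not free. (i) ⇔ (ii) and (ii) ⇒ (iii) are proved with no extra condition. *)

theory Defs
  imports "HOL-Analysis.Analysis" "HOL-Algebra.Group_Action"
    "HOL-Library.Extended_Nat" "HOL-Library.Equipollence"
begin

section \<open>Coxeter groups\<close>

locale right_angled_coxeter_matrix =
  fixes I :: "'i set" and M :: "'i \<Rightarrow> 'i \<Rightarrow> enat"
  assumes finite_index: "finite I"
    and diagonal: "i \<in> I \<Longrightarrow> M i i = 1"
    and symmetric: "i \<in> I \<Longrightarrow> j \<in> I \<Longrightarrow> M i j = M j i"
    and right_angled: "i \<in> I \<Longrightarrow> j \<in> I \<Longrightarrow> i \<noteq> j \<Longrightarrow> M i j \<in> {2, \<infinity>}"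

text \<open>
  The Coxeter group is given by its presentation
  \<open>\<langle>s\<^sub>i (i \<in> I) | (s\<^sub>i s\<^sub>j)^m\<^sub>i\<^sub>j = 1 whenever m\<^sub>i\<^sub>j < \<infinity>\<rangle>\<close>.
  Since \<open>m\<^sub>i\<^sub>i = 1\<close> makes every generator an involution, inverse letters are not needed: the
  elements are the classes of words over \<open>I\<close> modulo insertion and deletion of relators.
\<close>

inductive_set coxeter_rel :: "'i set \<Rightarrow> ('i \<Rightarrow> 'i \<Rightarrow> enat) \<Rightarrow> ('i list \<times> 'i list) set"
  for I :: "'i set" and M :: "'i \<Rightarrow> 'i \<Rightarrow> enat"
where
  relator: "\<lbrakk>u \<in> lists I; v \<in> lists I; i \<in> I; j \<in> I; M i j = enat m\<rbrakk>
     \<Longrightarrow> (u @ concat (replicate m [i, j]) @ v, u @ v) \<in> coxeter_rel I M"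
| refl: "w \<in> lists I \<Longrightarrow> (w, w) \<in> coxeter_rel I M"
| sym: "(v, w) \<in> coxeter_rel I M \<Longrightarrow> (w, v) \<in> coxeter_rel I M"
| trans: "\<lbrakk>(u, v) \<in> coxeter_rel I M; (v, w) \<in> coxeter_rel I M\<rbrakk> \<Longrightarrow> (u, w) \<in> coxeter_rel I M"

definition word_elt :: "'i set \<Rightarrow> ('i \<Rightarrow> 'i \<Rightarrow> enat) \<Rightarrow> 'i list \<Rightarrow> 'i list set" where
  "word_elt I M w = coxeter_rel I M `` {w}"

definition coxeter_group :: "'i set \<Rightarrow> ('i \<Rightarrow> 'i \<Rightarrow> enat) \<Rightarrow> 'i list set monoid" where
  "coxeter_group I M =
     \<lparr>carrier = lists I // coxeter_rel I M,
      mult = (\<lambda>A B. \<Union>a\<in>A. \<Union>b\<in>B. word_elt I M (a @ b)),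
      one = word_elt I M []\<rparr>"

definition reduced_word :: "'i set \<Rightarrow> ('i \<Rightarrow> 'i \<Rightarrow> enat) \<Rightarrow> 'i list \<Rightarrow> bool" where
  "reduced_word I M w \<longleftrightarrow> w \<in> lists I \<and>
     (\<forall>v\<in>lists I. word_elt I M v = word_elt I M w \<longrightarrow> length w \<le> length v)"

lemma coxeter_rel_lists:
  assumes "(v, w) \<in> coxeter_rel I M"
  shows "v \<in> lists I \<and> w \<in> lists I"
  using assms by induction (auto simp: in_lists_conv_set set_replicate_conv_if split: if_splits)

lemma equiv_coxeter_rel: "equiv (lists I) (coxeter_rel I M)"
proof (rule equivI)
  show "coxeter_rel I M \<subseteq> lists I \<times> lists I"
    using coxeter_rel_lists by fast
  show "refl_on (lists I) (coxeter_rel I M)"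
    by (rule refl_onI) (rule coxeter_rel.refl)
  show "sym (coxeter_rel I M)"
    by (rule symI) (rule coxeter_rel.sym)
  show "trans (coxeter_rel I M)"
    by (rule transI) (rule coxeter_rel.trans)
qed

lemma word_elt_eq_iff:
  "v \<in> lists I \<Longrightarrow> w \<in> lists I \<Longrightarrow> word_elt I M v = word_elt I M w \<longleftrightarrow> (v, w) \<in> coxeter_rel I M"
  unfolding word_elt_def by (rule eq_equiv_class_iff[OF equiv_coxeter_rel])

lemma coxeter_rel_append:
  assumes "(v, w) \<in> coxeter_rel I M" "a \<in> lists I" "b \<in> lists I"
  shows "(a @ v @ b, a @ w @ b) \<in> coxeter_rel I M"
  using assms
proof induction
  case (relator u v i j m)
  have "((a @ u) @ concat (replicate m [i, j]) @ (v @ b), (a @ u) @ (v @ b)) \<in> coxeter_rel I M"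
    by (rule coxeter_rel.relator) (use relator in auto)
  then show ?case by simp
next
  case (refl w)
  then show ?case by (intro coxeter_rel.refl) auto
next
  case (sym v w)
  then show ?case by (blast intro: coxeter_rel.sym)
next
  case (trans u v w)
  then show ?case by (blast intro: coxeter_rel.trans)
qed

lemma word_elt_mult:
  assumes "v \<in> lists I" "w \<in> lists I"
  shows "word_elt I M v \<otimes>\<^bsub>coxeter_group I M\<^esub> word_elt I M w = word_elt I M (v @ w)"
proof -
  have "word_elt I M (a @ b) = word_elt I M (v @ w)"
    if "a \<in> word_elt I M v" "b \<in> word_elt I M w" for a b
  proof -
    have a: "(v, a) \<in> coxeter_rel I M" and b: "(w, b) \<in> coxeter_rel I M"
      using that by (auto simp: word_elt_def)
    have "(v @ w, a @ w) \<in> coxeter_rel I M"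
      using coxeter_rel_append[OF a, of "[]" w] assms by simp
    moreover have "(a @ w, a @ b) \<in> coxeter_rel I M"
      using coxeter_rel_append[OF b, of a "[]"] coxeter_rel_lists[OF a] by simp
    ultimately have "(v @ w, a @ b) \<in> coxeter_rel I M"
      by (rule coxeter_rel.trans)
    then show ?thesis
      unfolding word_elt_def using equiv_class_eq[OF equiv_coxeter_rel] by blast
  qed
  moreover have "v \<in> word_elt I M v" "w \<in> word_elt I M w"
    using assms by (auto simp: word_elt_def intro: coxeter_rel.refl)
  ultimately have "(\<Union>a\<in>word_elt I M v. \<Union>b\<in>word_elt I M w. word_elt I M (a @ b)) = word_elt I M (v @ w)"
    by blast
  then show ?thesis
    by (simp add: coxeter_group_def)
qed

lemma carrier_coxeter_group: "carrier (coxeter_group I M) = word_elt I M ` lists I"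
  by (auto simp: coxeter_group_def quotient_def word_elt_def)

context right_angled_coxeter_matrix
begin

lemma word_elt_inverse:
  assumes "w \<in> lists I"
  shows "word_elt I M (rev w @ w) = word_elt I M []"
  using assms
proof (induction w)
  case (Cons i w)
  have "(rev w @ concat (replicate 1 [i, i]) @ w, rev w @ w) \<in> coxeter_rel I M"
    using Cons.hyps diagonal[of i] by (intro coxeter_rel.relator) (auto simp: one_enat_def)
  then have "word_elt I M (rev (i # w) @ (i # w)) = word_elt I M (rev w @ w)"
    by (subst word_elt_eq_iff) (use Cons.hyps in \<open>auto\<close>)
  then show ?case using Cons.IH by simp
qed simp

lemma group_coxeter_group: "group (coxeter_group I M)"
proof (rule groupI)
  show one: "\<one>\<^bsub>coxeter_group I M\<^esub> \<in> carrier (coxeter_group I M)"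
    unfolding carrier_coxeter_group by (simp add: coxeter_group_def)
  fix x assume "x \<in> carrier (coxeter_group I M)"
  then obtain u where u: "u \<in> lists I" and x: "x = word_elt I M u"
    unfolding carrier_coxeter_group by blast
  have one_eq: "\<one>\<^bsub>coxeter_group I M\<^esub> = word_elt I M []"
    by (simp add: coxeter_group_def)
  show "\<one>\<^bsub>coxeter_group I M\<^esub> \<otimes>\<^bsub>coxeter_group I M\<^esub> x = x"
    unfolding x one_eq using word_elt_mult[of "[]" I u M] u by simp
  have u': "rev u \<in> lists I" using u by auto
  have "word_elt I M (rev u) \<otimes>\<^bsub>coxeter_group I M\<^esub> x = \<one>\<^bsub>coxeter_group I M\<^esub>"
    unfolding x one_eq word_elt_mult[OF u' u] by (rule word_elt_inverse[OF u])
  then show "\<exists>y\<in>carrier (coxeter_group I M). y \<otimes>\<^bsub>coxeter_group I M\<^esub> x = \<one>\<^bsub>coxeter_group I M\<^esub>"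
    unfolding carrier_coxeter_group using u' by blast
  fix y assume "y \<in> carrier (coxeter_group I M)"
  then obtain v where v: "v \<in> lists I" and y: "y = word_elt I M v"
    unfolding carrier_coxeter_group by blast
  have uv: "u @ v \<in> lists I" using u v by simp
  show "x \<otimes>\<^bsub>coxeter_group I M\<^esub> y \<in> carrier (coxeter_group I M)"
    unfolding x y word_elt_mult[OF u v] carrier_coxeter_group using uv by blast
  fix z assume "z \<in> carrier (coxeter_group I M)"
  then obtain w where w: "w \<in> lists I" and z: "z = word_elt I M w"
    unfolding carrier_coxeter_group by blast
  have vw: "v @ w \<in> lists I" using v w by simp
  show "x \<otimes>\<^bsub>coxeter_group I M\<^esub> y \<otimes>\<^bsub>coxeter_group I M\<^esub> z =
      x \<otimes>\<^bsub>coxeter_group I M\<^esub> (y \<otimes>\<^bsub>coxeter_group I M\<^esub> z)"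
    unfolding x y z word_elt_mult[OF u v] word_elt_mult[OF v w]
      word_elt_mult[OF uv w] word_elt_mult[OF u vw] by simp
qed

end


section \<open>Right-angled buildings\<close>

text \<open>The set of chambers is the (nonempty) universe of the type \<open>'c\<close>.\<close>

definition panels :: "('i \<Rightarrow> ('c \<times> 'c) set) \<Rightarrow> 'i \<Rightarrow> 'c set set" where
  "panels adj i = UNIV // adj i"

fun gallery :: "('i \<Rightarrow> ('c \<times> 'c) set) \<Rightarrow> 'c \<Rightarrow> 'i list \<Rightarrow> 'c \<Rightarrow> bool" where
  "gallery adj c [] d \<longleftrightarrow> c = d"
| "gallery adj c (i # w) d \<longleftrightarrow> (\<exists>c'. (c, c') \<in> adj i \<and> c \<noteq> c' \<and> gallery adj c' w d)"

locale right_angled_building = right_angled_coxeter_matrix I M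
  for I :: "'i set" and M :: "'i \<Rightarrow> 'i \<Rightarrow> enat" +
  fixes adj :: "'i \<Rightarrow> ('c \<times> 'c) set"
    and \<delta> :: "'c \<Rightarrow> 'c \<Rightarrow> 'i list set"
  assumes equiv_adj: "i \<in> I \<Longrightarrow> equiv UNIV (adj i)"
    and panel_two: "i \<in> I \<Longrightarrow> P \<in> panels adj i \<Longrightarrow> \<exists>c\<in>P. \<exists>d\<in>P. c \<noteq> d"
    and \<delta>_closed: "\<delta> c d \<in> carrier (coxeter_group I M)"
    and \<delta>_gallery: "reduced_word I M w \<Longrightarrow> \<delta> c d = word_elt I M w \<longleftrightarrow> gallery adj c w d"

text \<open>The parameter \<open>q\<^sub>i\<close> is a cardinal, represented by a set \<open>Xs i\<close> of that cardinality.\<close>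

definition semiregular :: "'i set \<Rightarrow> ('i \<Rightarrow> ('c \<times> 'c) set) \<Rightarrow> ('i \<Rightarrow> 'x set) \<Rightarrow> bool" where
  "semiregular I adj Xs \<longleftrightarrow> (\<forall>i\<in>I. \<forall>P\<in>panels adj i. P \<approx> Xs i)"

definition building_auts :: "'i set \<Rightarrow> ('i \<Rightarrow> ('c \<times> 'c) set) \<Rightarrow> ('c \<Rightarrow> 'c) set" where
  "building_auts I adj =
     {g \<in> Bij UNIV. \<forall>i\<in>I. \<forall>c d. (g c, g d) \<in> adj i \<longleftrightarrow> (c, d) \<in> adj i}"


section \<open>Universal groups\<close>

definition legal_colouring ::
    "'i set \<Rightarrow> ('i \<Rightarrow> ('c \<times> 'c) set) \<Rightarrow> ('i \<Rightarrow> 'x set) \<Rightarrow> ('i \<Rightarrow> 'c \<Rightarrow> 'x) \<Rightarrow> bool" where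
  "legal_colouring I adj Xs col \<longleftrightarrow>
     (\<forall>i\<in>I. col i \<in> UNIV \<rightarrow> Xs i) \<and>
     (\<forall>i\<in>I. \<forall>P\<in>panels adj i. bij_betw (col i) P (Xs i) \<and>
        (\<forall>j\<in>I. j \<noteq> i \<longrightarrow> col j constant_on P))"

definition local_action ::
    "('i \<Rightarrow> 'x set) \<Rightarrow> ('i \<Rightarrow> 'c \<Rightarrow> 'x) \<Rightarrow> ('c \<Rightarrow> 'c) \<Rightarrow> 'i \<Rightarrow> 'c set \<Rightarrow> 'x \<Rightarrow> 'x" where
  "local_action Xs col g i P = (\<lambda>x\<in>Xs i. col i (g (inv_into P (col i) x)))"

definition universal_set ::
    "'i set \<Rightarrow> ('i \<Rightarrow> ('c \<times> 'c) set) \<Rightarrow> ('i \<Rightarrow> 'x set) \<Rightarrow> ('i \<Rightarrow> 'c \<Rightarrow> 'x) \<Rightarrow>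
      ('i \<Rightarrow> ('x \<Rightarrow> 'x) set) \<Rightarrow> ('c \<Rightarrow> 'c) set" where
  "universal_set I adj Xs col F =
     {g \<in> building_auts I adj. \<forall>i\<in>I. \<forall>P\<in>panels adj i. local_action Xs col g i P \<in> F i}"

definition universal_group ::
    "'i set \<Rightarrow> ('i \<Rightarrow> ('c \<times> 'c) set) \<Rightarrow> ('i \<Rightarrow> 'x set) \<Rightarrow> ('i \<Rightarrow> 'c \<Rightarrow> 'x) \<Rightarrow>
      ('i \<Rightarrow> ('x \<Rightarrow> 'x) set) \<Rightarrow> ('c \<Rightarrow> 'c) monoid" where
  "universal_group I adj Xs col F = (BijGroup UNIV)\<lparr>carrier := universal_set I adj Xs col F\<rparr>"


section \<open>Free actions and the permutation topology\<close>

definition acts_freely :: "('g, 'b) monoid_scheme \<Rightarrow> 'a set \<Rightarrow> ('g \<Rightarrow> 'a \<Rightarrow> 'a) \<Rightarrow> bool" where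
  "acts_freely G E \<phi> \<longleftrightarrow> (\<forall>x\<in>E. stabilizer G \<phi> x = {\<one>\<^bsub>G\<^esub>})"

definition pointwise_stabilizer ::
    "('g, 'b) monoid_scheme \<Rightarrow> ('g \<Rightarrow> 'a \<Rightarrow> 'a) \<Rightarrow> 'a set \<Rightarrow> 'g set" where
  "pointwise_stabilizer G \<phi> S = {g \<in> carrier G. \<forall>x\<in>S. \<phi> g x = x}"

text \<open>
  The group topology in which the pointwise stabilisers of finite sets form a neighbourhood basis
  of the identity, so that their left translates by \<open>g\<close> form one of \<open>g\<close>.
\<close>

definition permutation_topology ::
    "('g, 'b) monoid_scheme \<Rightarrow> 'a set \<Rightarrow> ('g \<Rightarrow> 'a \<Rightarrow> 'a) \<Rightarrow> 'g topology" where
  "permutation_topology G E \<phi> = topology (\<lambda>V. V \<subseteq> carrier G \<and>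
     (\<forall>g\<in>V. \<exists>S. finite S \<and> S \<subseteq> E \<and> g <#\<^bsub>G\<^esub> pointwise_stabilizer G \<phi> S \<subseteq> V))"

lemma openin_permutation_topology:
  "openin (permutation_topology G E \<phi>) V \<longleftrightarrow> V \<subseteq> carrier G \<and>
     (\<forall>g\<in>V. \<exists>S. finite S \<and> S \<subseteq> E \<and> g <#\<^bsub>G\<^esub> pointwise_stabilizer G \<phi> S \<subseteq> V)"
proof -
  let ?N = "\<lambda>g S V. finite S \<and> S \<subseteq> E \<and> g <#\<^bsub>G\<^esub> pointwise_stabilizer G \<phi> S \<subseteq> V"
  have "istopology (\<lambda>V. V \<subseteq> carrier G \<and> (\<forall>g\<in>V. \<exists>S. ?N g S V))"
    unfolding istopology_def
  proof (intro conjI allI impI ballI)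
    fix V W g
    assume V: "V \<subseteq> carrier G \<and> (\<forall>g\<in>V. \<exists>S. ?N g S V)"
      and W: "W \<subseteq> carrier G \<and> (\<forall>g\<in>W. \<exists>S. ?N g S W)"
    show "V \<inter> W \<subseteq> carrier G" using V by auto
    assume g: "g \<in> V \<inter> W"
    obtain S where S: "?N g S V" using bspec[OF conjunct2[OF V] IntD1[OF g]] by auto
    obtain T where T: "?N g T W" using bspec[OF conjunct2[OF W] IntD2[OF g]] by auto
    have "g <#\<^bsub>G\<^esub> pointwise_stabilizer G \<phi> (S \<union> T) \<subseteq> A"
      if "g <#\<^bsub>G\<^esub> pointwise_stabilizer G \<phi> S \<subseteq> A \<or> g <#\<^bsub>G\<^esub> pointwise_stabilizer G \<phi> T \<subseteq> A" for A
      using that unfolding l_coset_def pointwise_stabilizer_def by auto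
    then have "?N g (S \<union> T) (V \<inter> W)"
      using S T by simp
    then show "\<exists>S. ?N g S (V \<inter> W)" by (rule exI)
  next
    fix \<V> g
    assume \<V>: "\<forall>V\<in>\<V>. V \<subseteq> carrier G \<and> (\<forall>g\<in>V. \<exists>S. ?N g S V)"
    show "\<Union>\<V> \<subseteq> carrier G" using \<V> by auto
    assume "g \<in> \<Union>\<V>"
    then obtain V where V: "V \<in> \<V>" "g \<in> V" by auto
    obtain S where "?N g S V" using bspec[OF conjunct2[OF bspec[OF \<V> V(1)]] V(2)] by auto
    then have "?N g S (\<Union>\<V>)" using V(1) by auto
    then show "\<exists>S. ?N g S (\<Union>\<V>)" by (rule exI)
  qed
  then show ?thesis
    unfolding permutation_topology_def by (simp add: topology_inverse')
qed

text \<open>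
  No node of the Coxeter diagram is isolated (equivalently, every irreducible component has rank at
  least two).  Without this condition a discrete universal group need not come from free local
  groups: if \<open>i\<close> is the only index, then \<open>\<Delta>\<close> is one \<open>i\<close>-panel and \<open>\<U>(F)\<close> is \<open>F\<^sub>i\<close>
  acting on it, which is discrete for \<open>F\<^sub>i = Sym(3)\<close> although this action is not free.
\<close>

definition no_isolated_node :: "'i set \<Rightarrow> ('i \<Rightarrow> 'i \<Rightarrow> enat) \<Rightarrow> bool" where
  "no_isolated_node I M \<longleftrightarrow> (\<forall>i\<in>I. \<exists>j\<in>I. M i j = \<infinity>)"

end

theory Submission
  imports Defs
begin

text \<open>
  If all local groups are free, an element of the universal group that fixes a chamber \<open>c\<close> has, at
  each panel of \<open>c\<close>, a local action fixing the colour of \<open>c\<close>; that local action is trivial, so the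
  neighbours of \<open>c\<close> are fixed too, and by connectedness everything is. If the universal group acts
  freely, the stabiliser of one chamber is trivial, so the permutation topology is discrete.

  For the converses, let \<open>f \<in> F\<^sub>i\<close> fix a colour \<open>x\<close>; an element of the universal group is built that
  permutes \<open>i\<close>-colours by \<open>f\<close> and fixes a chamber \<open>c\<close> of colour \<open>x\<close>. For freeness it suffices to apply \<open>f\<close>
  to the \<open>i\<close>-colours of all chambers. For discreteness, any finite set \<open>S\<close> of chambers has to be
  fixed as well. Take \<open>j\<close> with \<open>m\<^sub>i\<^sub>j = \<infinity>\<close> and let \<open>beyond j c\<close> be the set of chambers that a minimal
  gallery from \<open>c\<close> can reach by starting with a \<open>j\<close>-step, that is, the complement of the wing
  at \<open>c\<close> of its \<open>j\<close>-panel. Walking away along \<open>i, j, i, j, \<dots>\<close> one finds such a \<open>c\<close> with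
  \<open>S \<subseteq> beyond j c\<close> (\<open>finite_set_beyond\<close>). The \<open>i\<close>-colours are permuted by \<open>f\<close> outside \<open>beyond j c\<close>
  only. This is consistent, because chambers of the two regions are adjacent only in \<open>j\<close>-panels
  parallel to that of \<open>c\<close>, and these have \<open>i\<close>-colour \<open>x\<close>, which \<open>f\<close> fixes (\<open>beyond_boundary\<close>).

  Both automorphisms come from \<open>exists_automorphism_with_local_actions\<close>: local actions can be
  prescribed panel by panel, subject only to local compatibility. Following a gallery and
  its coloured copy simultaneously gives a chamber system of pairs with the same commuting
  squares as the building. In such a system every gallery can be shortened until its type is
  reduced, and in the building a closed gallery of reduced type is empty. So a
  connected component of this system has at most one pair over each chamber, and is the graph of a
  map. The
  combinatorial input is the easily checked criterion \<open>reduced_if_cancellation_free\<close> for a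
  word to be reduced.
\<close>

section \<open>Words in a right-angled Coxeter group\<close>

context right_angled_coxeter_matrix
begin

text \<open>
  The letter \<open>i\<close> can be brought to the front of the word by swapping commuting neighbours.
\<close>

fun can_lead :: "'i \<Rightarrow> 'i list \<Rightarrow> bool" where
  "can_lead i [] \<longleftrightarrow> False"
| "can_lead i (k # w) \<longleftrightarrow> k = i \<or> (M i k = 2 \<and> can_lead i w)"

text \<open>
  Read through \<open>cancellation_free_iff_split\<close>: no two equal letters can be made adjacent by
  commutations. These are the reduced words; the recursive form fits inductions in which galleries
  are extended at their starting chamber.
\<close>

fun cancellation_free :: "'i list \<Rightarrow> bool" where
  "cancellation_free [] \<longleftrightarrow> True"
| "cancellation_free (i # w) \<longleftrightarrow> cancellation_free w \<and> \<not> can_lead i w"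

lemma not_commute_self: "i \<in> I \<Longrightarrow> M i i \<noteq> 2"
  using diagonal[of i] by (simp add: one_enat_def numeral_eq_enat)

lemma can_lead_iff_split:
  "can_lead i w \<longleftrightarrow> (\<exists>v z. w = v @ i # z \<and> (\<forall>b\<in>set v. M i b = 2))"
proof (induction w)
  case (Cons k w)
  show ?case
  proof
    assume "can_lead i (k # w)"
    then consider "k = i" | "M i k = 2" "can_lead i w" by auto
    then show "\<exists>v z. k # w = v @ i # z \<and> (\<forall>b\<in>set v. M i b = 2)"
    proof cases
      case 1
      then show ?thesis by (intro exI[of _ "[]"] exI[of _ w]) simp
    next
      case 2
      then obtain v z where "w = v @ i # z" "\<forall>b\<in>set v. M i b = 2" using Cons.IH by auto
      then show ?thesis using 2 by (intro exI[of _ "k # v"] exI[of _ z]) simp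
    qed
  next
    assume "\<exists>v z. k # w = v @ i # z \<and> (\<forall>b\<in>set v. M i b = 2)"
    then obtain v z where "k # w = v @ i # z" "\<forall>b\<in>set v. M i b = 2" by auto
    then show "can_lead i (k # w)" using Cons.IH by (cases v) auto
  qed
qed simp

lemma cancellation_free_iff_split:
  "cancellation_free w \<longleftrightarrow>
     \<not> (\<exists>u i v z. w = u @ i # v @ i # z \<and> (\<forall>b\<in>set v. M i b = 2))"
proof (induction w)
  case (Cons k w)
  show ?case
  proof
    assume L: "cancellation_free (k # w)"
    show "\<not> (\<exists>u i v z. k # w = u @ i # v @ i # z \<and> (\<forall>b\<in>set v. M i b = 2))"
    proof
      assume "\<exists>u i v z. k # w = u @ i # v @ i # z \<and> (\<forall>b\<in>set v. M i b = 2)"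
      then obtain u i v z where w: "k # w = u @ i # v @ i # z" and v: "\<forall>b\<in>set v. M i b = 2"
        by auto
      show False
      proof (cases u)
        case Nil
        then have "can_lead k w" using w v unfolding can_lead_iff_split by auto
        then show False using L by simp
      next
        case (Cons k' u')
        then have "w = u' @ i # v @ i # z" using w by simp
        then have "\<not> cancellation_free w" using v Cons.IH by blast
          then show False using L by simp
      qed
    qed
  next
    assume R: "\<not> (\<exists>u i v z. k # w = u @ i # v @ i # z \<and> (\<forall>b\<in>set v. M i b = 2))"
    have "cancellation_free w"
      unfolding Cons.IH
    proof
      assume "\<exists>u i v z. w = u @ i # v @ i # z \<and> (\<forall>b\<in>set v. M i b = 2)"
      then obtain u i v z where "k # w = (k # u) @ i # v @ i # z" "\<forall>b\<in>set v. M i b = 2" by auto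
      then show False using R by blast
    qed
    moreover have "\<not> can_lead k w"
    proof
      assume "can_lead k w"
      then obtain v z where "k # w = [] @ k # v @ k # z" "\<forall>b\<in>set v. M k b = 2"
        unfolding can_lead_iff_split by auto
      then show False using R by blast
    qed
    ultimately show "cancellation_free (k # w)" by simp
  qed
qed simp

lemma cancellation_free_rev: "cancellation_free (rev w) \<longleftrightarrow> cancellation_free w"
proof -
  have "cancellation_free w" if "cancellation_free (rev w)" for w
    unfolding cancellation_free_iff_split
  proof
    assume "\<exists>u i v z. w = u @ i # v @ i # z \<and> (\<forall>b\<in>set v. M i b = 2)"
    then obtain u i v z where "w = u @ i # v @ i # z" "\<forall>b\<in>set v. M i b = 2" by auto
    then have "rev w = rev z @ i # rev v @ i # rev u" "\<forall>b\<in>set (rev v). M i b = 2" by auto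
    then show False using that unfolding cancellation_free_iff_split by blast
  qed
  from this[of w] this[of "rev w"] show ?thesis by auto
qed

lemma cancellation_free_prefix: "cancellation_free (v @ w) \<Longrightarrow> cancellation_free v"
  unfolding cancellation_free_iff_split[of v] cancellation_free_iff_split[of "v @ w"] by force

lemma can_lead_remove1:
  assumes "i \<noteq> k" "M i k = 2"
  shows "can_lead i (remove1 k w) \<longleftrightarrow> can_lead i w"
  using assms by (induction w) auto

lemma cancellation_free_remove1:
  assumes "cancellation_free w" "can_lead i w" "i \<in> I" "w \<in> lists I"
  shows "cancellation_free (remove1 i w)" "\<not> can_lead i (remove1 i w)"
  using assms
proof (induction w)
  case (Cons k w)
  { case 1
    then show ?case using Cons.IH(1) symmetric[of i k] by (auto simp: can_lead_remove1)
  next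
    case 2
    then show ?case using Cons.IH(2) by auto }
qed auto

text \<open>
  Equality of words up to swaps of commuting neighbours. A word is determined up to such swaps by
  its projections to the pairs of letters that do not commute (and to single letters, \<open>a = b\<close>), and
  with projections the relation is visibly an equivalence that deletion of letters respects.
\<close>

definition trace_equiv :: "'i list \<Rightarrow> 'i list \<Rightarrow> bool" where
  "trace_equiv v w \<longleftrightarrow> (\<forall>a\<in>I. \<forall>b\<in>I. M a b \<noteq> 2 \<longrightarrow>
     filter (\<lambda>x. x = a \<or> x = b) v = filter (\<lambda>x. x = a \<or> x = b) w)"

lemma trace_equiv_refl: "trace_equiv w w"
  and trace_equiv_sym: "trace_equiv v w \<Longrightarrow> trace_equiv w v"
  and trace_equiv_trans: "trace_equiv u v \<Longrightarrow> trace_equiv v w \<Longrightarrow> trace_equiv u w"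
  by (simp_all add: trace_equiv_def)

lemma trace_equiv_length:
  assumes "trace_equiv v w" "v \<in> lists I" "w \<in> lists I"
  shows "length v = length w"
proof -
  have "mset v = mset w"
  proof (rule multiset_eqI)
    fix a :: 'i
    have count: "count (mset r) a = length (filter (\<lambda>x. x = a \<or> x = a) r)" for r
      by (induction r) auto
    have "filter (\<lambda>x. x = a \<or> x = a) v = filter (\<lambda>x. x = a \<or> x = a) w"
    proof (cases "a \<in> I")
      case True
      then show ?thesis using assms(1) not_commute_self unfolding trace_equiv_def by blast
    next
      case False
      then have "filter (\<lambda>x. x = a \<or> x = a) r = []" if "r \<in> lists I" for r
        using that by (auto simp: filter_empty_conv)
      then show ?thesis using assms(2,3) by simp
    qed
    then show "count (mset v) a = count (mset w) a" by (simp only: count)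
  qed
  then show ?thesis by (rule mset_eq_length)
qed

lemma can_lead_iff_filter:
  assumes "i \<in> I" "w \<in> lists I"
  shows "can_lead i w \<longleftrightarrow>
    (\<forall>b\<in>I. M i b \<noteq> 2 \<longrightarrow> (\<exists>t. filter (\<lambda>x. x = i \<or> x = b) w = i # t))"
  using assms(2)
proof (induction w)
  case Nil
  then show ?case using assms(1) not_commute_self by auto
next
  case (Cons k w)
  consider "k = i" | "k \<noteq> i" "M i k = 2" | "k \<noteq> i" "M i k \<noteq> 2" by blast
  then show ?case
  proof cases
    case 2
    then have "filter (\<lambda>x. x = i \<or> x = b) (k # w) = filter (\<lambda>x. x = i \<or> x = b) w"
      if "M i b \<noteq> 2" for b using that by auto
    then show ?thesis using 2 Cons by auto
  next
    case 3
    then have "\<not> (\<exists>t. filter (\<lambda>x. x = i \<or> x = k) (k # w) = i # t)" by auto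
    then show ?thesis using 3 Cons.hyps by auto
  qed auto
qed

text \<open>
  Left multiplication by a generator, on cancellation-free words up to commutation. That it respects
  the defining relations of the group (\<open>push_push_same\<close>, \<open>push_commute\<close>) makes \<open>normalize\<close>, up to
  commutation, an invariant of group elements.
\<close>

definition push :: "'i \<Rightarrow> 'i list \<Rightarrow> 'i list" where
  "push i w = (if can_lead i w then remove1 i w else i # w)"

lemma push_lists: "i \<in> I \<Longrightarrow> w \<in> lists I \<Longrightarrow> push i w \<in> lists I"
  using set_remove1_subset[of i w] by (auto simp: push_def)

lemma cancellation_free_push:
  "\<lbrakk>cancellation_free w; i \<in> I; w \<in> lists I\<rbrakk> \<Longrightarrow> cancellation_free (push i w)"
  by (simp add: push_def cancellation_free_remove1)

lemma push_cong:
  assumes "trace_equiv v w" "i \<in> I" "v \<in> lists I" "w \<in> lists I"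
  shows "trace_equiv (push i v) (push i w)"
proof -
  have "can_lead i v \<longleftrightarrow> can_lead i w"
    using assms by (simp add: can_lead_iff_filter trace_equiv_def cong: ball_cong)
  then show ?thesis
    using assms(1) by (auto simp: push_def trace_equiv_def filter_remove1)
qed

lemma push_push_same:
  assumes "cancellation_free w" "i \<in> I" "w \<in> lists I"
  shows "trace_equiv (push i (push i w)) w"
proof (cases "can_lead i w")
  case True
  have "filter (\<lambda>x. x = a \<or> x = b) (i # remove1 i w) = filter (\<lambda>x. x = a \<or> x = b) w"
    if ab: "a \<in> I" "b \<in> I" "M a b \<noteq> 2" for a b
  proof -
    consider "a = i" | "b = i" | "a \<noteq> i" "b \<noteq> i" by blast
    then show ?thesis
    proof cases
      case 1
      then obtain t where "filter (\<lambda>x. x = a \<or> x = b) w = i # t"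
        using True ab can_lead_iff_filter assms by blast
      then show ?thesis using 1 by (simp add: filter_remove1)
    next
      case 2
      then have "M i a \<noteq> 2" using ab symmetric by auto
      then obtain t where "filter (\<lambda>x. x = i \<or> x = a) w = i # t"
        using True ab can_lead_iff_filter assms by blast
      then have "filter (\<lambda>x. x = a \<or> x = b) w = i # t" using 2 by (simp add: disj_commute)
      then show ?thesis using 2 by (simp add: filter_remove1)
    next
      case 3
      then show ?thesis by (auto simp: filter_remove1 remove1_idem)
    qed
  qed
  then show ?thesis
    using True cancellation_free_remove1(2)[OF assms(1) True assms(2,3)]
    by (simp add: push_def trace_equiv_def)
next
  case False
  then show ?thesis by (simp add: push_def trace_equiv_refl)
qed

lemma push_commute:
  assumes "i \<in> I" "j \<in> I" "M i j = 2"
  shows "trace_equiv (push i (push j w)) (push j (push i w))"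
proof -
  have ij: "i \<noteq> j" "M j i = 2" using assms not_commute_self symmetric by auto
  have "can_lead i (push j w) = can_lead i w" "can_lead j (push i w) = can_lead j w"
    using assms ij by (auto simp: push_def can_lead_remove1)
  then show ?thesis
    using assms ij by (auto simp: push_def trace_equiv_def remove1_commute)
qed

definition normalize :: "'i list \<Rightarrow> 'i list" where
  "normalize w = foldr push w []"

lemma normalize_simps [simp]:
  "normalize [] = []" "normalize (i # w) = push i (normalize w)"
  by (simp_all add: normalize_def)

lemma normalize_lists: "w \<in> lists I \<Longrightarrow> normalize w \<in> lists I"
proof (induction w)
  case (Cons i w)
  then show ?case using push_lists[of i "normalize w"] by simp
qed simp

lemma cancellation_free_normalize: "w \<in> lists I \<Longrightarrow> cancellation_free (normalize w)"
proof (induction w)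
  case (Cons i w)
  then show ?case
    using cancellation_free_push[of "normalize w" i] normalize_lists[of w] by simp
qed simp

lemma length_normalize: "length (normalize w) \<le> length w"
proof (induction w)
  case (Cons i w)
  then show ?case by (auto simp: push_def length_remove1)
qed simp

lemma normalize_cancellation_free: "cancellation_free w \<Longrightarrow> normalize w = w"
  by (induction w) (auto simp: push_def)

lemma normalize_append_cong:
  assumes "trace_equiv (normalize v) (normalize w)" "u \<in> lists I" "v \<in> lists I" "w \<in> lists I"
  shows "trace_equiv (normalize (u @ v)) (normalize (u @ w))"
  using assms(2)
proof (induction u)
  case (Cons i u)
  then have "normalize (u @ v) \<in> lists I" "normalize (u @ w) \<in> lists I"
    using assms normalize_lists by auto
  then show ?case using Cons push_cong by auto
qed (use assms in auto)

lemma normalize_relator: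
  assumes "i \<in> I" "j \<in> I" "M i j = enat m" "v \<in> lists I"
  shows "trace_equiv (normalize (concat (replicate m [i, j]) @ v)) (normalize v)"
proof (cases "i = j")
  case True
  then have "m = 1" using assms diagonal[of i] by (simp add: one_enat_def)
  then show ?thesis
    using True assms cancellation_free_normalize normalize_lists push_push_same by simp
next
  case False
  then have m: "m = 2" and c: "M i j = 2"
    using assms right_angled[of i j] by (auto simp: numeral_eq_enat)
  let ?r = "normalize v"
  have r: "?r \<in> lists I" "cancellation_free ?r"
    using assms(4) by (auto simp only: cancellation_free_normalize normalize_lists)
  have L: "push a w \<in> lists I" if "w \<in> lists I" "a \<in> {i, j}" for a w
    using that assms push_lists by auto
  have C: "cancellation_free (push a w)" if "cancellation_free w" "w \<in> lists I" "a \<in> {i, j}" for a w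
    using that assms cancellation_free_push by auto
  have "trace_equiv (push j (push i (push j ?r))) (push i (push j (push j ?r)))"
    using push_commute[of i j "push j ?r"] c assms trace_equiv_sym by blast
  moreover have "trace_equiv (push i (push j (push j ?r))) (push i ?r)"
    using push_cong push_push_same r L assms by simp
  ultimately have "trace_equiv (push j (push i (push j ?r))) (push i ?r)"
    by (rule trace_equiv_trans)
  then have "trace_equiv (push i (push j (push i (push j ?r)))) (push i (push i ?r))"
    using push_cong r L assms by simp
  then have "trace_equiv (push i (push j (push i (push j ?r)))) ?r"
    using push_push_same r assms trace_equiv_trans by blast
  then show ?thesis by (simp add: m numeral_2_eq_2)
qed

lemma normalize_coxeter_rel:
  "(v, w) \<in> coxeter_rel I M \<Longrightarrow> trace_equiv (normalize v) (normalize w)"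
proof (induction rule: coxeter_rel.induct)
  case (relator u v i j m)
  have "concat (replicate m [i, j]) \<in> lists I"
    using relator by (auto simp: in_lists_conv_set)
  then show ?case
    using relator normalize_relator by (intro normalize_append_cong) auto
qed (auto intro: trace_equiv_refl trace_equiv_sym trace_equiv_trans)

text \<open>
  A cancellation-free word is its own normal form, normal forms of words for the same element have
  equal length, and normalizing never lengthens a word.
\<close>

theorem reduced_if_cancellation_free:
  assumes "w \<in> lists I" "cancellation_free w"
  shows "reduced_word I M w"
  unfolding reduced_word_def
proof (intro conjI ballI impI)
  fix v assume v: "v \<in> lists I" "word_elt I M v = word_elt I M w"
  then have "trace_equiv (normalize v) (normalize w)"
    using word_elt_eq_iff[of v I w M] assms normalize_coxeter_rel by blast
  then have "length (normalize v) = length w"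
    using trace_equiv_length normalize_lists v assms normalize_cancellation_free by metis
  then show "length w \<le> length v" using length_normalize[of v] by simp
qed (use assms in auto)

section \<open>Galleries\<close>

lemma gallery_append:
  "gallery A a (v @ w) b \<longleftrightarrow> (\<exists>c. gallery A a v c \<and> gallery A c w b)"
  by (induction v arbitrary: a) auto

text \<open>
  Stated for an arbitrary family of relations, because it is applied both to the adjacencies of
  the building and to the pairs of chambers from which automorphisms are constructed.
\<close>

definition commuting_squares :: "('i \<Rightarrow> ('c \<times> 'c) set) \<Rightarrow> bool" where
  "commuting_squares A \<longleftrightarrow> (\<forall>k\<in>I. \<forall>l\<in>I. M k l = 2 \<longrightarrow>
     (\<forall>a b. gallery A a [k, l] b \<longrightarrow> gallery A a [l, k] b))"

lemma gallery_rev: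
  assumes "\<And>k. k \<in> I \<Longrightarrow> sym (A k)" "w \<in> lists I" "gallery A a w b"
  shows "gallery A b (rev w) a"
  using assms(2,3)
proof (induction w arbitrary: a)
  case (Cons k w)
  then obtain c where c: "(a, c) \<in> A k" "a \<noteq> c" "gallery A c w b" by auto
  then have "(c, a) \<in> A k" using assms(1) Cons.hyps by (auto dest: symD)
  then show ?case using c Cons.IH by (auto simp: gallery_append)
qed simp

text \<open>
  Bringing \<open>i\<close> to the front swaps it past letters that commute with it, and each swap replaces two sides
  of a square by the other two.
\<close>

lemma gallery_pull_front:
  assumes "commuting_squares A" "i \<in> I" "w \<in> lists I" "can_lead i w" "gallery A a w b"
  shows "gallery A a (i # remove1 i w) b"
  using assms(3-5)
proof (induction w arbitrary: a)
  case (Cons k w)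
  show ?case
  proof (cases "k = i")
    case False
    with Cons have k: "M k i = 2" "can_lead i w" using symmetric assms(2) by auto
    from Cons.prems obtain c where c: "(a, c) \<in> A k" "a \<noteq> c" "gallery A c w b" by auto
    then obtain d where d: "(c, d) \<in> A i" "c \<noteq> d" "gallery A d (remove1 i w) b"
      using Cons.IH k by auto
    then have "gallery A a [k, i] d" using c by auto
    then have "gallery A a [i, k] d"
      using assms(1,2) k Cons.hyps unfolding commuting_squares_def by blast
    then have "gallery A a ([i, k] @ remove1 i w) b"
      using d(3) by (intro gallery_append[THEN iffD2] exI[of _ d] conjI)
    then show ?thesis using False by simp
  qed (use Cons in auto)
qed simp

text \<open>
  Moving the starting chamber inside its \<open>k\<close>-panel. If the gallery cannot be made to start with a
  \<open>k\<close>-step, it is prolonged by one; otherwise the new start lies in the first panel that the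
  rearranged gallery crosses, and is either its second chamber or a third one.
\<close>

lemma gallery_step:
  assumes sq: "commuting_squares A" and eq: "sym (A k)" "trans (A k)"
    and k: "k \<in> I" and w: "w \<in> lists I" "gallery A a w b" and a: "(a, a') \<in> A k" "a \<noteq> a'"
  shows "\<not> can_lead k w \<and> gallery A a' (k # w) b \<or>
     can_lead k w \<and> (gallery A a' (k # remove1 k w) b \<or> gallery A a' (remove1 k w) b)"
proof (cases "can_lead k w")
  case True
  then obtain c where c: "(a, c) \<in> A k" "gallery A c (remove1 k w) b"
    using gallery_pull_front[OF sq k w(1) True w(2)] by auto
  have "(a', c) \<in> A k" using c a eq by (meson symD transD)
  then show ?thesis using c True by (cases "a' = c") auto
next
  case False
  then show ?thesis using a w eq by (auto dest: symD)
qed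

lemma gallery_cancellation_free:
  assumes sq: "commuting_squares A" and eq: "\<And>k. k \<in> I \<Longrightarrow> sym (A k)" "\<And>k. k \<in> I \<Longrightarrow> trans (A k)"
    and "w \<in> lists I" "gallery A a w b"
  shows "\<exists>r\<in>lists I. cancellation_free r \<and> gallery A a r b"
  using assms(4,5)
proof (induction w arbitrary: a)
  case Nil
  then show ?case by (intro bexI[of _ "[]"]) auto
next
  case (Cons k w)
  then have k: "k \<in> I" by simp
  from Cons obtain c where "(a, c) \<in> A k" and c': "c \<noteq> a" "gallery A c w b" by auto
  then have c: "(c, a) \<in> A k" using symD[OF eq(1)[OF k]] by blast
  obtain r where r: "r \<in> lists I" "cancellation_free r" "gallery A c r b" using Cons c' by blast
  have rem: "remove1 k r \<in> lists I" using r set_remove1_subset[of k r] by auto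
  have "k # r \<in> lists I" "k # remove1 k r \<in> lists I" using rem r k by auto
  then show ?case
    using gallery_step[OF sq eq[OF k] k r(1,3) c c'(1)] rem
      cancellation_free_remove1[OF r(2) _ k r(1)] r(2) cancellation_free.simps(2) by metis
qed

end


section \<open>Prescribing the local actions of an automorphism\<close>

context right_angled_building
begin

lemma sym_adj: "k \<in> I \<Longrightarrow> sym (adj k)"
  by (rule equivE[OF equiv_adj])

lemma trans_adj: "k \<in> I \<Longrightarrow> trans (adj k)"
  by (rule equivE[OF equiv_adj])

lemma adj_refl: "k \<in> I \<Longrightarrow> (c, c) \<in> adj k"
  by (rule equivE[OF equiv_adj]) (auto simp: refl_on_def)

text \<open>
  The words \<open>k l\<close> and \<open>l k\<close> are reduced and represent the same element, so the Weyl distance provides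
  galleries of both types.
\<close>

lemma commuting_squares_adj: "commuting_squares adj"
  unfolding commuting_squares_def
proof (intro ballI allI impI)
  fix k l a b
  assume k: "k \<in> I" and l: "l \<in> I" and kl: "M k l = 2" and g: "gallery adj a [k, l] b"
  have ne: "k \<noteq> l" using k kl not_commute_self by auto
  have rel: "M l k = enat 2" using k l kl symmetric by (simp add: numeral_eq_enat)
  have "([k, l] @ concat (replicate 2 [l, k]) @ [], [k, l] @ []) \<in> coxeter_rel I M"
    by (rule coxeter_rel.relator) (use k l rel in auto)
  then have "([k, l, l, k, l, k], [k, l]) \<in> coxeter_rel I M"
    by (simp add: numeral_2_eq_2)
  moreover have "([k] @ concat (replicate 1 [l, l]) @ [k, l, k], [k] @ [k, l, k]) \<in> coxeter_rel I M"
    by (rule coxeter_rel.relator) (use k l diagonal in \<open>auto simp: one_enat_def\<close>)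
  then have "([k, l, l, k, l, k], [k, k, l, k]) \<in> coxeter_rel I M" by simp
  moreover have "([] @ concat (replicate 1 [k, k]) @ [l, k], [] @ [l, k]) \<in> coxeter_rel I M"
    by (rule coxeter_rel.relator) (use k l diagonal in \<open>auto simp: one_enat_def\<close>)
  then have "([k, k, l, k], [l, k]) \<in> coxeter_rel I M" by simp
  ultimately have "([k, l], [l, k]) \<in> coxeter_rel I M"
    by (metis coxeter_rel.sym coxeter_rel.trans)
  then have "word_elt I M [k, l] = word_elt I M [l, k]"
    using k l word_elt_eq_iff[of "[k, l]" I "[l, k]" M] by simp
  moreover have "reduced_word I M [k, l]" "reduced_word I M [l, k]"
    using k l ne by (auto intro!: reduced_if_cancellation_free)
  ultimately show "gallery adj a [l, k] b" using g \<delta>_gallery by metis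
qed

lemma closed_gallery_empty:
  assumes "gallery adj c w c" "cancellation_free w" "w \<in> lists I"
  shows "w = []"
proof -
  have "\<delta> c c = word_elt I M w" using assms \<delta>_gallery reduced_if_cancellation_free by blast
  moreover have "\<delta> c c = word_elt I M []"
    using \<delta>_gallery[of "[]" c c] reduced_if_cancellation_free[of "[]"] by simp
  ultimately show ?thesis
    using reduced_if_cancellation_free[OF assms(3,2)] unfolding reduced_word_def
    by (metis length_0_conv le_zero_eq list.size(3) lists.Nil)
qed

lemma connected: "\<exists>w\<in>lists I. cancellation_free w \<and> gallery adj c w d"
proof -
  obtain v where v: "v \<in> lists I" "\<delta> c d = word_elt I M v"
    using \<delta>_closed[of c d] unfolding carrier_coxeter_group by blast
  define w where "w = arg_min length (\<lambda>w. w \<in> lists I \<and> word_elt I M w = word_elt I M v)"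
  have "w \<in> lists I \<and> word_elt I M w = word_elt I M v"
    unfolding w_def by (rule arg_min_natI[of _ v]) (use v in auto)
  moreover have "length w \<le> length u" if "u \<in> lists I \<and> word_elt I M u = word_elt I M v" for u
    unfolding w_def by (rule arg_min_nat_le) (use that in auto)
  ultimately have "reduced_word I M w" "\<delta> c d = word_elt I M w" "w \<in> lists I"
    using v by (auto simp: reduced_word_def)
  then have "gallery adj c w d" using \<delta>_gallery by blast
  then show ?thesis
    using gallery_cancellation_free[OF commuting_squares_adj sym_adj trans_adj] \<open>w \<in> lists I\<close>
    by blast
qed

end

locale coloured_building = right_angled_building I M adj \<delta>
  for I :: "'i set" and M :: "'i \<Rightarrow> 'i \<Rightarrow> enat"
    and adj :: "'i \<Rightarrow> ('c \<times> 'c) set" and \<delta> :: "'c \<Rightarrow> 'c \<Rightarrow> 'i list set" +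
  fixes Xs :: "'i \<Rightarrow> 'x set" and col :: "'i \<Rightarrow> 'c \<Rightarrow> 'x"
  assumes legal: "legal_colouring I adj Xs col"
begin

lemma panel_of: "k \<in> I \<Longrightarrow> adj k `` {c} \<in> panels adj k"
  by (simp add: panels_def quotientI)

lemma col_in: "k \<in> I \<Longrightarrow> col k c \<in> Xs k"
  using legal unfolding legal_colouring_def by blast

lemma col_bij: "k \<in> I \<Longrightarrow> bij_betw (col k) (adj k `` {c}) (Xs k)"
  using legal panel_of[of k c] unfolding legal_colouring_def by blast

lemma col_const: "\<lbrakk>k \<in> I; l \<in> I; k \<noteq> l; (c, d) \<in> adj l\<rbrakk> \<Longrightarrow> col k c = col k d"
proof -
  assume a: "k \<in> I" "l \<in> I" "k \<noteq> l" "(c, d) \<in> adj l"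
  then have "col k constant_on (adj l `` {c})"
    using legal panel_of[of l c] unfolding legal_colouring_def by blast
  then obtain x where "\<forall>e\<in>adj l `` {c}. col k e = x" unfolding constant_on_def by blast
  moreover have "c \<in> adj l `` {c}" "d \<in> adj l `` {c}" using a adj_refl by simp_all
  ultimately show ?thesis by simp
qed

lemma col_inj: "\<lbrakk>k \<in> I; (c, d) \<in> adj k; col k c = col k d\<rbrakk> \<Longrightarrow> c = d"
  by (rule inj_onD[OF bij_betw_imp_inj_on[OF col_bij[of k c]]]) (simp_all add: adj_refl)

lemma col_surj: "\<lbrakk>k \<in> I; x \<in> Xs k\<rbrakk> \<Longrightarrow> \<exists>d. (c, d) \<in> adj k \<and> col k d = x"
proof -
  assume k: "k \<in> I" and "x \<in> Xs k"
  then have "x \<in> col k ` (adj k `` {c})" using bij_betw_imp_surj_on[OF col_bij[OF k]] by simp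
  then show ?thesis by auto
qed

lemma col_const_gallery:
  assumes "k \<in> I" "w \<in> lists I" "k \<notin> set w" "gallery adj c w d"
  shows "col k c = col k d"
  using assms(2-4)
proof (induction w arbitrary: c)
  case (Cons l w)
  then obtain e where e: "(c, e) \<in> adj l" "gallery adj e w d" by auto
  have "col k c = col k e" using Cons.prems Cons.hyps e assms(1) by (intro col_const[of k l c e]) auto
  moreover have "col k e = col k d" using Cons.prems e by (intro Cons.IH) auto
  ultimately show ?case by simp
qed simp

text \<open>
  The permutation \<open>\<psi> k d\<close> of \<open>Xs k\<close> is the local action prescribed at the \<open>k\<close>-panel of \<open>d\<close>. Around a
  commuting square the two parallel \<open>k\<close>-panels must carry the same prescription; along any other step
  from \<open>d\<close> to \<open>e\<close> the \<open>k\<close>-colour does not change, so the two prescriptions need only agree on that one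
  colour.

  A chamber \<open>c'\<close> is matched with \<open>c\<close> when its colours are the prescribed images of those of \<open>c\<close>. Matched
  pairs form a chamber system that covers the building under both projections. A gallery
  of pairs whose ends agree in one coordinate can be made cancellation-free, and its projection
  is then a closed gallery of reduced type, hence empty. So the component of the base pair is
  the graph of a bijection.
\<close>

theorem exists_automorphism_with_local_actions:
  assumes bij: "\<And>k d. k \<in> I \<Longrightarrow> bij_betw (\<psi> k d) (Xs k) (Xs k)"
    and commuting: "\<And>k l d e. \<lbrakk>k \<in> I; l \<in> I; l = k \<or> M k l = 2; (d, e) \<in> adj l\<rbrakk> \<Longrightarrow> \<psi> k d = \<psi> k e"
    and boundary: "\<And>k l d e. \<lbrakk>k \<in> I; l \<in> I; k \<noteq> l; (d, e) \<in> adj l\<rbrakk>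
      \<Longrightarrow> \<psi> k d (col k d) = \<psi> k e (col k e)"
    and base: "\<And>k. k \<in> I \<Longrightarrow> col k c' = \<psi> k c (col k c)"
  shows "\<exists>g\<in>building_auts I adj. g c = c' \<and> (\<forall>k\<in>I. \<forall>d. col k (g d) = \<psi> k d (col k d))"
proof -
  define matched where "matched p \<longleftrightarrow> (\<forall>k\<in>I. col k (snd p) = \<psi> k (fst p) (col k (fst p)))" for p
  define A where "A k = {(p, q). matched p \<and> matched q \<and>
    (fst p, fst q) \<in> adj k \<and> (snd p, snd q) \<in> adj k}" for k
  have A_iff: "(p, q) \<in> A k \<longleftrightarrow> matched p \<and> matched q \<and>
    (fst p, fst q) \<in> adj k \<and> (snd p, snd q) \<in> adj k" for k p q
    by (simp add: A_def)
  have symA: "sym (A k)" if "k \<in> I" for k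
    by (rule symI) (auto simp: A_iff dest: symD[OF sym_adj[OF that]])
  have transA: "trans (A k)" if "k \<in> I" for k
  proof (rule transI)
    fix p q r assume "(p, q) \<in> A k" "(q, r) \<in> A k"
    then show "(p, r) \<in> A k"
      using transD[OF trans_adj[OF that], of "fst p" "fst q" "fst r"]
        transD[OF trans_adj[OF that], of "snd p" "snd q" "snd r"] by (simp add: A_iff)
  qed
  have inj_\<psi>: "x = y" if "k \<in> I" "\<psi> k d x = \<psi> k d y" "x \<in> Xs k" "y \<in> Xs k" for k d x y
    using bij[OF that(1)] that unfolding bij_betw_def inj_on_def by blast
  \<comment> \<open>Proper steps stay proper in both coordinates, since chambers of a panel differ in colour.\<close>
  have snd_eq_iff: "fst p = fst q \<longleftrightarrow> snd p = snd q" if "k \<in> I" "(p, q) \<in> A k" for k p q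
  proof -
    have "col k (snd q) = \<psi> k (fst p) (col k (fst q))"
      using that commuting[of k k "fst p" "fst q"] by (auto simp: A_iff matched_def)
    moreover have "col k (snd p) = \<psi> k (fst p) (col k (fst p))"
      using that by (auto simp: A_iff matched_def)
    moreover have "(fst p, fst q) \<in> adj k" "(snd p, snd q) \<in> adj k" using that by (auto simp: A_iff)
    ultimately show ?thesis
      using col_inj[OF that(1), of "fst p" "fst q"] col_inj[OF that(1), of "snd p" "snd q"]
        inj_\<psi>[OF that(1), of "fst p" "col k (fst p)" "col k (fst q)"] col_in[OF that(1)] by metis
  qed
  have proj: "gallery adj (fst p) w (fst q)" "gallery adj (snd p) w (snd q)"
    if "w \<in> lists I" "gallery A p w q" for w p q
    using that
  proof (induction w arbitrary: p)
    case (Cons k w)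
    { case 1
      then obtain r where r: "(p, r) \<in> A k" "p \<noteq> r" "gallery A r w q" by auto
      then have "fst p \<noteq> fst r" using snd_eq_iff[of k p r] Cons.hyps by (auto simp: prod_eq_iff)
      then show ?case using Cons.IH(1)[of r] 1 r by (auto simp: A_iff)
    next
      case 2
      then obtain r where r: "(p, r) \<in> A k" "p \<noteq> r" "gallery A r w q" by auto
      then have "snd p \<noteq> snd r" using snd_eq_iff[of k p r] Cons.hyps by (auto simp: prod_eq_iff)
      then show ?case using Cons.IH(2)[of r] 2 r by (auto simp: A_iff) }
  qed auto
  have squares: "commuting_squares A"
    unfolding commuting_squares_def
  proof (intro ballI allI impI)
    fix k l p q
    assume k: "k \<in> I" and l: "l \<in> I" and kl: "M k l = 2" and g: "gallery A p [k, l] q"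
    have ne: "k \<noteq> l" and lk: "M l k = 2" using k l kl not_commute_self symmetric by auto
    have w: "[k, l] \<in> lists I" using k l by simp
    have m: "matched p" "matched q" using g by (auto simp: A_iff)
    obtain b where b: "(fst p, b) \<in> adj l" "fst p \<noteq> b" "(b, fst q) \<in> adj k" "b \<noteq> fst q"
      using commuting_squares_adj proj(1)[OF w g] k l kl unfolding commuting_squares_def by force
    obtain b' where b': "(snd p, b') \<in> adj l" "(b', snd q) \<in> adj k"
      using commuting_squares_adj proj(2)[OF w g] k l kl unfolding commuting_squares_def by force
    have "col n b' = \<psi> n b (col n b)" if n: "n \<in> I" for n
    proof (cases "n = l")
      case True
      have "col l b' = col l (snd q)" using col_const[of l k] b' k l ne by auto
      also have "\<dots> = \<psi> l (fst q) (col l (fst q))" using m l by (simp add: matched_def)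
      also have "\<dots> = \<psi> l b (col l b)" using boundary[of l k b "fst q"] b k l ne by auto
      finally show ?thesis using True by simp
    next
      case False
      have "col n b' = col n (snd p)" using col_const[of n l] b' n l False by auto
      also have "\<dots> = \<psi> n (fst p) (col n (fst p))" using m n by (simp add: matched_def)
      also have "\<dots> = \<psi> n b (col n b)" using boundary[of n l "fst p" b] b n l False by auto
      finally show ?thesis .
    qed
    then have "matched (b, b')" by (simp add: matched_def)
    then have "(p, (b, b')) \<in> A l" "((b, b'), q) \<in> A k" using b b' m by (auto simp: A_iff)
    moreover have "p \<noteq> (b, b')" "(b, b') \<noteq> q" using b by auto
    ultimately show "gallery A p [l, k] q" by (simp del: split_paired_Ex) blast
  qed
  define reach where "reach p \<longleftrightarrow> (\<exists>w\<in>lists I. gallery A (c, c') w p)" for p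
  have reach_matched: "matched p" if "reach p" for p
  proof -
    have "matched q \<Longrightarrow> gallery A q w p \<Longrightarrow> matched p" for w q
      by (induction w arbitrary: q) (auto simp: A_iff)
    moreover have "matched (c, c')" using base by (simp add: matched_def)
    ultimately show ?thesis using that unfolding reach_def by blast
  qed
  have reach_base: "reach (c, c')" unfolding reach_def by (rule bexI[of _ "[]"]) auto
  have reach_step: "reach q" if "reach p" "(p, q) \<in> A k" "k \<in> I" for p q k
  proof (cases "p = q")
    case False
    from that(1)[unfolded reach_def] obtain w where w: "w \<in> lists I" "gallery A (c, c') w p" ..
    have "gallery A p [k] q" using that(2) False by (simp del: split_paired_Ex)
    then have "gallery A (c, c') (w @ [k]) q" using w(2) unfolding gallery_append by blast
    moreover have "w @ [k] \<in> lists I" using w that by auto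
    ultimately show ?thesis unfolding reach_def by blast
  next
    case True
    then show ?thesis using that(1) by simp
  qed
  have reach_unique: "p = q" if pq: "reach p" "reach q" "fst p = fst q \<or> snd p = snd q" for p q
  proof -
    from pq(1)[unfolded reach_def] obtain v where v: "v \<in> lists I" "gallery A (c, c') v p" ..
    from pq(2)[unfolded reach_def] obtain w where w: "w \<in> lists I" "gallery A (c, c') w q" ..
    have "gallery A p (rev v @ w) q"
      using gallery_rev[OF symA v] w(2) unfolding gallery_append by blast
    moreover have "rev v @ w \<in> lists I" using v w by auto
    ultimately obtain r where r: "r \<in> lists I" "cancellation_free r" "gallery A p r q"
      using gallery_cancellation_free[OF squares symA transA] by blast
    then have "r = []"
      using proj[OF r(1,3)] pq(3) closed_gallery_empty[OF _ r(2,1)] by metis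
    then show ?thesis using r by simp
  qed
  \<comment> \<open>A step in one coordinate lifts: the colour of the target in its panel is forced.\<close>
  have lift_fst: "\<exists>d'. ((a, a'), (d, d')) \<in> A k"
    if h: "matched (a, a')" "k \<in> I" "(a, d) \<in> adj k" for a a' d k
  proof -
    have "\<psi> k a (col k d) \<in> Xs k" using bij[OF h(2)] col_in[OF h(2)] by (auto simp: bij_betw_def)
    then obtain d' where d': "(a', d') \<in> adj k" "col k d' = \<psi> k a (col k d)"
      using col_surj h by blast
    have "col n d' = \<psi> n d (col n d)" if n: "n \<in> I" for n
    proof (cases "n = k")
      case True
      then show ?thesis using d' commuting[of k k a d] h by simp
    next
      case False
      then show ?thesis
        using col_const[of n k a' d'] boundary[of n k a d] d' h n by (simp add: matched_def)
    qed
    then show ?thesis using h d' by (auto simp: A_iff matched_def)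
  qed
  have lift_snd: "\<exists>d. ((a, a'), (d, d')) \<in> A k"
    if h: "matched (a, a')" "k \<in> I" "(a', d') \<in> adj k" for a a' d' k
  proof -
    obtain x where x: "x \<in> Xs k" "\<psi> k a x = col k d'"
      using bij_betw_imp_surj_on[OF bij[OF h(2)], of a] col_in[OF h(2), of d'] by (metis imageE)
    then obtain d where d: "(a, d) \<in> adj k" "col k d = x" using col_surj h by blast
    have "col n d' = \<psi> n d (col n d)" if n: "n \<in> I" for n
    proof (cases "n = k")
      case True
      then show ?thesis using d x commuting[of k k a d] h by simp
    next
      case False
      then show ?thesis
        using col_const[of n k a' d'] boundary[of n k a d] d h n by (simp add: matched_def)
    qed
    then show ?thesis using h d by (auto simp: A_iff matched_def)
  qed
  have total_fst: "\<exists>d'. reach (d, d')" for d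
  proof -
    have "\<exists>d'. reach (d, d')" if "w \<in> lists I" "gallery adj a w d" "reach (a, a')" for w a a'
      using that
    proof (induction w arbitrary: a a')
      case (Cons k w)
      then obtain b where b: "(a, b) \<in> adj k" "gallery adj b w d" by auto
      then obtain b' where "((a, a'), (b, b')) \<in> A k"
        using lift_fst[of a a' k b] reach_matched Cons.prems Cons.hyps by blast
      then have "reach (b, b')" using reach_step Cons.prems Cons.hyps by blast
      then show ?case using Cons.IH b by blast
    qed auto
    then show ?thesis using connected[of c d] reach_base by blast
  qed
  have total_snd: "\<exists>d. reach (d, d')" for d'
  proof -
    have "\<exists>d. reach (d, d')" if "w \<in> lists I" "gallery adj a' w d'" "reach (a, a')" for w a a'
      using that
    proof (induction w arbitrary: a a')
      case (Cons k w)
      then obtain b' where b': "(a', b') \<in> adj k" "gallery adj b' w d'" by auto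
      then obtain b where "((a, a'), (b, b')) \<in> A k"
        using lift_snd[of a a' k b'] reach_matched Cons.prems Cons.hyps by blast
      then have "reach (b, b')" using reach_step Cons.prems Cons.hyps by blast
      then show ?case using Cons.IH b' by blast
    qed auto
    then show ?thesis using connected[of c' d'] reach_base by blast
  qed
  define g where "g d = (SOME d'. reach (d, d'))" for d
  have g: "reach (d, g d)" for d unfolding g_def using total_fst by (rule someI_ex)
  have g_eq: "g d = d'" if "reach (d, d')" for d d' using reach_unique[OF g that] by simp
  have "inj g"
  proof (rule injI)
    fix d e assume "g d = g e"
    then show "d = e" using reach_unique[OF g[of d] g[of e]] by simp
  qed
  moreover have "surj g" unfolding surj_def using total_snd g_eq by metis
  ultimately have "g \<in> Bij UNIV" by (simp add: Bij_def bij_betw_def)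
  moreover have "(g d, g e) \<in> adj k \<longleftrightarrow> (d, e) \<in> adj k" if k: "k \<in> I" for d e k
  proof
    assume "(d, e) \<in> adj k"
    from lift_fst[OF reach_matched[OF g] k this] obtain e' where e': "((d, g d), (e, e')) \<in> A k" ..
    have "g e = e'" by (rule g_eq[OF reach_step[OF g e' k]])
    then show "(g d, g e) \<in> adj k" using e' by (simp add: A_iff)
  next
    assume "(g d, g e) \<in> adj k"
    from lift_snd[OF reach_matched[OF g] k this] obtain e' where e': "((d, g d), (e', g e)) \<in> A k" ..
    then have "e' = e" using reach_unique[OF reach_step[OF g e' k] g[of e]] by simp
    then show "(d, e) \<in> adj k" using e' by (simp add: A_iff)
  qed
  ultimately have "g \<in> building_auts I adj" by (simp add: building_auts_def)
  moreover have "g c = c'" using g_eq reach_base by blast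
  moreover have "col k (g d) = \<psi> k d (col k d)" if "k \<in> I" for k d
    using reach_matched[OF g[of d]] that by (simp add: matched_def)
  ultimately show ?thesis by blast
qed

end

section \<open>The region beyond a panel\<close>

context right_angled_building
begin

lemma neighbour: "k \<in> I \<Longrightarrow> \<exists>d. (c, d) \<in> adj k \<and> c \<noteq> d"
proof -
  assume k: "k \<in> I"
  have "adj k `` {c} \<in> panels adj k" by (simp add: panels_def quotientI)
  then obtain d e where "(c, d) \<in> adj k" "(c, e) \<in> adj k" "d \<noteq> e"
    using panel_two[OF k] by blast
  then show ?thesis by (cases "c = d") auto
qed

lemma cancellation_free_step:
  assumes k: "k \<in> I" and r: "r \<in> lists I" "cancellation_free r" "gallery adj a r b"
    and a: "(a, a') \<in> adj k" "a \<noteq> a'"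
  obtains "cancellation_free (k # r)" "gallery adj a' (k # r) b"
  | "can_lead k r" "remove1 k r \<in> lists I" "cancellation_free (k # remove1 k r)"
      "gallery adj a' (k # remove1 k r) b"
  | "can_lead k r" "remove1 k r \<in> lists I" "cancellation_free (remove1 k r)"
      "gallery adj a' (remove1 k r) b"
proof -
  have "remove1 k r \<in> lists I" using r set_remove1_subset[of k r] by auto
  then show ?thesis
    using that gallery_step[OF commuting_squares_adj sym_adj[OF k] trans_adj[OF k] k r(1,3) a]
      cancellation_free_remove1[OF r(2) _ k r(1)] r(2) by auto
qed

text \<open>
  The chambers whose projection to the \<open>j\<close>-panel of \<open>c\<close> is not \<open>c\<close>: the complement of the wing of \<open>c\<close>
  in that panel.
\<close>

definition beyond :: "'i \<Rightarrow> 'c \<Rightarrow> 'c set" where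
  "beyond j c = {d. \<exists>w\<in>lists I. cancellation_free (j # w) \<and> gallery adj c (j # w) d}"

lemma beyondI:
  "\<lbrakk>w \<in> lists I; cancellation_free (j # w); gallery adj c (j # w) d\<rbrakk> \<Longrightarrow> d \<in> beyond j c"
  by (auto simp only: beyond_def)

lemma beyond_iff_rev:
  assumes "j \<in> I"
  shows "d \<in> beyond j c \<longleftrightarrow>
    (\<exists>w\<in>lists I. cancellation_free (w @ [j]) \<and> gallery adj d (w @ [j]) c)"
proof
  assume "d \<in> beyond j c"
  then obtain w where w: "w \<in> lists I" "cancellation_free (j # w)" "gallery adj c (j # w) d"
    unfolding beyond_def by blast
  have jw: "j # w \<in> lists I" using w assms by simp
  have "cancellation_free (rev w @ [j])" using w(2) cancellation_free_rev[of "j # w"] by simp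
  moreover have "gallery adj d (rev w @ [j]) c" using gallery_rev[OF sym_adj jw w(3)] by simp
  ultimately show "\<exists>w\<in>lists I. cancellation_free (w @ [j]) \<and> gallery adj d (w @ [j]) c"
    using w(1) by (intro bexI[of _ "rev w"]) auto
next
  assume "\<exists>w\<in>lists I. cancellation_free (w @ [j]) \<and> gallery adj d (w @ [j]) c"
  then obtain w where w: "w \<in> lists I" "cancellation_free (w @ [j])" "gallery adj d (w @ [j]) c"
    by blast
  have wj: "w @ [j] \<in> lists I" using w assms by simp
  have "cancellation_free (j # rev w)" using w(2) cancellation_free_rev[of "w @ [j]"]
    by (simp del: cancellation_free.simps)
  moreover have "gallery adj c (j # rev w) d"
    using gallery_rev[OF sym_adj wj w(3)] by (simp del: gallery.simps)
  ultimately show "d \<in> beyond j c" using w(1) by (intro beyondI[of "rev w"]) auto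
qed

lemma beyondI_rev:
  "\<lbrakk>j \<in> I; w \<in> lists I; cancellation_free (w @ [j]); gallery adj d (w @ [j]) c\<rbrakk>
    \<Longrightarrow> d \<in> beyond j c"
  using beyond_iff_rev by blast

lemma not_beyond_self: "j \<in> I \<Longrightarrow> c \<notin> beyond j c"
proof
  assume "j \<in> I" "c \<in> beyond j c"
  then obtain w where w: "w \<in> lists I" "cancellation_free (j # w)" "gallery adj c (j # w) c"
    unfolding beyond_def by blast
  have "j # w \<in> lists I" using w \<open>j \<in> I\<close> by simp
  then show False using closed_gallery_empty[OF w(3,2)] by simp
qed

text \<open>
  Only a \<open>j\<close>-step can cross between the two regions: prepending an \<open>l\<close>-step to a gallery from \<open>d\<close> to \<open>c\<close>
  can cancel a letter \<open>l\<close> of its type, but never the final \<open>j\<close>.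
\<close>

lemma beyond_closed:
  assumes "j \<in> I" "l \<in> I" "l \<noteq> j" "(d, e) \<in> adj l" "d \<in> beyond j c"
  shows "e \<in> beyond j c"
proof (cases "d = e")
  case False
  obtain w where w: "w \<in> lists I" "cancellation_free (w @ [j])" "gallery adj d (w @ [j]) c"
    using assms beyond_iff_rev by blast
  have wj: "w @ [j] \<in> lists I" using w assms by simp
  have rem: "remove1 l (w @ [j]) = remove1 l w @ [j]" if "can_lead l (w @ [j])"
  proof -
    have "l \<in> set (w @ [j])" using that unfolding can_lead_iff_split by force
    then show ?thesis using assms(3) by (simp add: remove1_append)
  qed
  have I: "remove1 l w \<in> lists I" using w set_remove1_subset[of l w] by auto
  show ?thesis
    using assms(2) wj w(2,3) assms(4) False
  proof (rule cancellation_free_step)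
    assume "cancellation_free (l # w @ [j])" "gallery adj e (l # w @ [j]) c"
    then show ?thesis using w(1) assms(1,2) by (intro beyondI_rev[of j "l # w"]) simp_all
  next
    assume *: "can_lead l (w @ [j])" and "cancellation_free (l # remove1 l (w @ [j]))"
      "gallery adj e (l # remove1 l (w @ [j])) c"
    then show ?thesis using rem[OF *] I assms(1,2)
      by (intro beyondI_rev[of j "l # remove1 l w"]) simp_all
  next
    assume *: "can_lead l (w @ [j])" and "cancellation_free (remove1 l (w @ [j]))"
      "gallery adj e (remove1 l (w @ [j])) c"
    then show ?thesis using rem[OF *] I assms(1)
      by (intro beyondI_rev[of j "remove1 l w"]) simp_all
  qed
qed (use assms in simp)

text \<open>
  A reduced word that starts with \<open>j\<close> stays reduced when another letter, not commuting with \<open>j\<close>, is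
  prepended.
\<close>

lemma beyond_alternate:
  assumes "i \<in> I" "j \<in> I" "i \<noteq> j" "M i j \<noteq> 2" "(c, c') \<in> adj i" "c \<noteq> c'"
  shows "beyond j c \<subseteq> beyond i c'"
proof
  fix s assume "s \<in> beyond j c"
  then obtain w where w: "w \<in> lists I" "cancellation_free (j # w)" "gallery adj c (j # w) s"
    unfolding beyond_def by blast
  have "cancellation_free (i # j # w)" using w(2) assms by auto
  moreover have "gallery adj c' (i # j # w) s"
    using w(3) assms(5,6) symD[OF sym_adj[OF assms(1)]] by auto
  ultimately show "s \<in> beyond i c'" using w(1) assms(2) by (intro beyondI[of "j # w"]) auto
qed

lemma beyond_or_closer:
  assumes "k \<in> I" "r \<in> lists I" "cancellation_free r" "gallery adj c r s"
    and "(c, c') \<in> adj k" "c \<noteq> c'"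
  shows "s \<in> beyond k c' \<or>
    (\<exists>r'\<in>lists I. cancellation_free r' \<and> gallery adj c' r' s \<and> length r' < length r)"
  using assms
proof (rule cancellation_free_step)
  assume "cancellation_free (k # r)" "gallery adj c' (k # r) s"
  then show ?thesis using beyondI[OF assms(2)] by blast
next
  assume "remove1 k r \<in> lists I" "cancellation_free (k # remove1 k r)"
    "gallery adj c' (k # remove1 k r) s"
  then show ?thesis using beyondI by blast
next
  assume l: "can_lead k r" and rem: "remove1 k r \<in> lists I" "cancellation_free (remove1 k r)"
    "gallery adj c' (remove1 k r) s"
  have "k \<in> set r" using l unfolding can_lead_iff_split by force
  then have "length (remove1 k r) < length r" using length_pos_if_in_set[of k r] by (simp add: length_remove1)
  then show ?thesis using rem by blast
qed

end

context coloured_building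
begin

text \<open>
  The step from \<open>e\<close> to \<open>d\<close> undoes the final \<open>j\<close> of a gallery from \<open>e\<close> to \<open>c\<close>, so all its other letters
  commute with \<open>j\<close>. Then \<open>i\<close> is not among them, and \<open>i\<close>-colours are constant along it.
\<close>

lemma beyond_boundary:
  assumes "j \<in> I" "(d, e) \<in> adj j" "d \<notin> beyond j c" "e \<in> beyond j c"
    and "i \<in> I" "i \<noteq> j" "M j i \<noteq> 2"
  shows "col i d = col i c"
proof -
  have ed: "(e, d) \<in> adj j" "e \<noteq> d" using assms symD[OF sym_adj[OF assms(1)]] by auto
  obtain w where w: "w \<in> lists I" "cancellation_free (w @ [j])" "gallery adj e (w @ [j]) c"
    using assms beyond_iff_rev by blast
  have wj: "w @ [j] \<in> lists I" using w assms by simp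
  have I: "remove1 j w \<in> lists I" using w set_remove1_subset[of j w] by auto
  have lead: "can_lead j (w @ [j]) \<and> j \<notin> set w"
    using assms(1) wj w(2,3) ed
  proof (rule cancellation_free_step)
    assume "cancellation_free (j # w @ [j])" "gallery adj d (j # w @ [j]) c"
    then have "d \<in> beyond j c"
      using w(1) assms(1) by (intro beyondI_rev[of j "j # w"]) simp_all
    then show ?thesis using assms by simp
  next
    assume *: "can_lead j (w @ [j])" "cancellation_free (j # remove1 j (w @ [j]))"
      "gallery adj d (j # remove1 j (w @ [j])) c"
    have "j \<notin> set w"
    proof
      assume "j \<in> set w"
      then have "d \<in> beyond j c" using * I assms(1)
        by (intro beyondI_rev[of j "j # remove1 j w"]) (simp_all add: remove1_append)
      then show False using assms(3) by simp
    qed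
    then show ?thesis using * by simp
  next
    assume *: "can_lead j (w @ [j])" "cancellation_free (remove1 j (w @ [j]))"
      "gallery adj d (remove1 j (w @ [j])) c"
    have "j \<notin> set w"
    proof
      assume "j \<in> set w"
      then have "d \<in> beyond j c" using * I assms(1)
        by (intro beyondI_rev[of j "remove1 j w"]) (simp_all add: remove1_append)
      then show False using assms(3) by simp
    qed
    then show ?thesis using * by simp
  qed
  have "M j b = 2" if "b \<in> set w" "can_lead j (w @ [j])" "j \<notin> set w" for b
    using that by (induction w) auto
  then have "i \<notin> set (w @ [j])" using lead assms(6,7) by auto
  then have "col i e = col i c" using col_const_gallery assms(5) wj w(3) by blast
  then show ?thesis using col_const[of i j d e] assms by simp
qed

text \<open>
  After each step of the walk \<open>i, j, i, j\<close> the chamber \<open>s\<close> is beyond the panel just crossed, and stays so,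
  or the walk has come closer to \<open>s\<close>; the latter can happen only finitely often. Two \<open>i\<close>-steps are used
  so that the walk leaves the colour of \<open>c\<close> and returns to it.
\<close>

lemma push_beyond:
  assumes ij: "i \<in> I" "j \<in> I" "i \<noteq> j" "M i j \<noteq> 2"
    and "r \<in> lists I" "cancellation_free r" "gallery adj c r s"
  shows "\<exists>c'. col i c' = col i c \<and> s \<in> beyond j c' \<and> beyond j c \<subseteq> beyond j c'"
  using assms(5-7)
proof (induction "length r" arbitrary: r c rule: less_induct)
  case less
  have ji: "j \<noteq> i" "M j i \<noteq> 2" using ij symmetric by auto
  obtain c1 where c1: "(c, c1) \<in> adj i" "c \<noteq> c1" using neighbour ij by blast
  obtain c2 where c2: "(c1, c2) \<in> adj j" "c1 \<noteq> c2" using neighbour ij by blast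
  obtain c3 where c3: "(c2, c3) \<in> adj i" "col i c3 = col i c"
    using col_surj col_in ij(1) by blast
  obtain c4 where c4: "(c3, c4) \<in> adj j" "c3 \<noteq> c4" using neighbour ij by blast
  have "col i c1 \<noteq> col i c" using col_inj[OF ij(1) c1(1)] c1(2) by auto
  moreover have "col i c1 = col i c2" using col_const[OF ij(1,2,3) c2(1)] .
  ultimately have c23: "c2 \<noteq> c3" using c3(2) by auto
  have col4: "col i c4 = col i c" using col_const[OF ij(1,2,3) c4(1)] c3(2) by simp
  have b1: "beyond j c \<subseteq> beyond i c1" by (rule beyond_alternate[OF ij c1])
  have b2: "beyond i c1 \<subseteq> beyond j c2" by (rule beyond_alternate[OF ij(2,1) ji c2])
  have b3: "beyond j c2 \<subseteq> beyond i c3" by (rule beyond_alternate[OF ij c3(1) c23])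
  have b4: "beyond i c3 \<subseteq> beyond j c4" by (rule beyond_alternate[OF ij(2,1) ji c4])
  show ?case
  proof (cases "s \<in> beyond j c4")
    case True
    then show ?thesis using col4 b1 b2 b3 b4 by blast
  next
    case False
    obtain r1 where r1: "r1 \<in> lists I" "cancellation_free r1" "gallery adj c1 r1 s"
      "length r1 < length r"
      using beyond_or_closer[OF ij(1) less.prems c1] False b2 b3 b4 by blast
    obtain r2 where r2: "r2 \<in> lists I" "cancellation_free r2" "gallery adj c2 r2 s"
      "length r2 < length r1"
      using beyond_or_closer[OF ij(2) r1(1-3) c2] False b3 b4 by blast
    obtain r3 where r3: "r3 \<in> lists I" "cancellation_free r3" "gallery adj c3 r3 s"
      "length r3 < length r2"
      using beyond_or_closer[OF ij(1) r2(1-3) c3(1) c23] False b4 by blast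
    obtain r4 where r4: "r4 \<in> lists I" "cancellation_free r4" "gallery adj c4 r4 s"
      "length r4 < length r3"
      using beyond_or_closer[OF ij(2) r3(1-3) c4] False by blast
    have "length r4 < length r" using r1 r2 r3 r4 by simp
    then obtain c' where "col i c' = col i c4" "s \<in> beyond j c'" "beyond j c4 \<subseteq> beyond j c'"
      using less.hyps r4(1-3) by blast
    then show ?thesis using col4 b1 b2 b3 b4 by (intro exI[of _ c']) auto
  qed
qed

lemma finite_set_beyond:
  assumes ij: "i \<in> I" "j \<in> I" "i \<noteq> j" "M i j \<noteq> 2" and x: "x \<in> Xs i" and "finite S"
  shows "\<exists>c. col i c = x \<and> S \<subseteq> beyond j c"
  using assms(6)
proof (induction S rule: finite_induct)
  case empty
  then show ?case using col_surj[OF ij(1) x] by auto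
next
  case (insert s S)
  then obtain c where c: "col i c = x" "S \<subseteq> beyond j c" by auto
  obtain r where "r \<in> lists I" "cancellation_free r" "gallery adj c r s" using connected by blast
  then obtain c' where "col i c' = col i c" "s \<in> beyond j c'" "beyond j c \<subseteq> beyond j c'"
    using push_beyond[OF ij] by blast
  then show ?case using c by (intro exI[of _ c']) auto
qed

text \<open>
  A chamber is determined within its \<open>l\<close>-panel by its \<open>l\<close>-colour.
\<close>

lemma automorphism_fixes_neighbour:
  assumes "g \<in> building_auts I adj" "l \<in> I" "(c, d) \<in> adj l" "g c = c" "col l (g d) = col l d"
  shows "g d = d"
proof -
  have "(g c, g d) \<in> adj l" using assms(1-3) unfolding building_auts_def by blast
  then have "(g d, c) \<in> adj l" using symD[OF sym_adj[OF assms(2)]] assms(4) by simp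
  then have "(g d, d) \<in> adj l" using transD[OF trans_adj[OF assms(2)]] assms(3) by blast
  then show ?thesis using col_inj[OF assms(2)] assms(5) by blast
qed

text \<open>
  A chamber beyond \<open>c\<close> is joined to \<open>c\<close> by a gallery that, after \<open>c\<close> itself, stays beyond \<open>c\<close>; along it,
  fixedness spreads from each chamber to the next.
\<close>

lemma automorphism_fixes_beyond:
  assumes g: "g \<in> building_auts I adj" "g c = c" and j: "j \<in> I"
    and cols: "\<And>k d. \<lbrakk>k \<in> I; d \<in> beyond j c\<rbrakk> \<Longrightarrow> col k (g d) = col k d"
    and d: "d \<in> beyond j c"
  shows "g d = d"
proof -
  have "g d = d" if "w \<in> lists I" "cancellation_free (j # w)" "gallery adj c (j # w) d" for w d
    using that
  proof (induction w arbitrary: d rule: rev_induct)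
    case Nil
    have "d \<in> beyond j c" by (rule beyondI[OF Nil])
    then show ?case using automorphism_fixes_neighbour[OF g(1) j _ g(2)] cols j Nil by auto
  next
    case (snoc l w)
    have l: "l \<in> I" "w \<in> lists I" using snoc.prems by auto
    obtain e where e: "gallery adj c (j # w) e" "(e, d) \<in> adj l"
      using snoc.prems(3) by (auto simp: gallery_append)
    have "cancellation_free (j # w)"
      using snoc.prems(2) cancellation_free_prefix[of "j # w" "[l]"] by simp
    then have "g e = e" using snoc.IH l e by blast
    moreover have "d \<in> beyond j c" by (rule beyondI[OF snoc.prems])
    ultimately show ?case using automorphism_fixes_neighbour[OF g(1) l(1) e(2)] cols l by blast
  qed
  then show ?thesis using d unfolding beyond_def by blast
qed

end

section \<open>Universal groups\<close>

lemma acts_freely_iff: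
  assumes "\<one>\<^bsub>G\<^esub> \<in> carrier G" "\<And>x. x \<in> E \<Longrightarrow> \<phi> \<one>\<^bsub>G\<^esub> x = x"
  shows "acts_freely G E \<phi> \<longleftrightarrow> (\<forall>g\<in>carrier G. \<forall>x\<in>E. \<phi> g x = x \<longrightarrow> g = \<one>\<^bsub>G\<^esub>)"
  using assms unfolding acts_freely_def stabilizer_def by blast

text \<open>
  The trivial subgroup is open exactly when it is one of the basic neighbourhoods of the identity, and
  all translates of it are open with it.
\<close>

lemma permutation_topology_discrete_iff:
  assumes one: "\<one>\<^bsub>G\<^esub> \<in> carrier G" "\<And>x. x \<in> E \<Longrightarrow> \<phi> \<one>\<^bsub>G\<^esub> x = x"
    and l_one: "\<And>g. g \<in> carrier G \<Longrightarrow> \<one>\<^bsub>G\<^esub> \<otimes>\<^bsub>G\<^esub> g = g"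
    and r_one: "\<And>g. g \<in> carrier G \<Longrightarrow> g \<otimes>\<^bsub>G\<^esub> \<one>\<^bsub>G\<^esub> = g"
  shows "permutation_topology G E \<phi> = discrete_topology (carrier G) \<longleftrightarrow>
    (\<exists>S. finite S \<and> S \<subseteq> E \<and> pointwise_stabilizer G \<phi> S = {\<one>\<^bsub>G\<^esub>})"
proof
  assume "permutation_topology G E \<phi> = discrete_topology (carrier G)"
  then have "openin (permutation_topology G E \<phi>) {\<one>\<^bsub>G\<^esub>}" using one by simp
  then obtain S where S: "finite S" "S \<subseteq> E"
    "\<one>\<^bsub>G\<^esub> <#\<^bsub>G\<^esub> pointwise_stabilizer G \<phi> S \<subseteq> {\<one>\<^bsub>G\<^esub>}"
    unfolding openin_permutation_topology by blast
  have "h = \<one>\<^bsub>G\<^esub>" if "h \<in> pointwise_stabilizer G \<phi> S" for h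
  proof -
    have "h \<in> carrier G" using that by (simp add: pointwise_stabilizer_def)
    then have "h \<in> \<one>\<^bsub>G\<^esub> <#\<^bsub>G\<^esub> pointwise_stabilizer G \<phi> S"
      using that l_one[of h] unfolding l_coset_def by force
    then show ?thesis using S by blast
  qed
  moreover have "\<one>\<^bsub>G\<^esub> \<in> pointwise_stabilizer G \<phi> S"
    using one S by (auto simp: pointwise_stabilizer_def)
  ultimately show "\<exists>S. finite S \<and> S \<subseteq> E \<and> pointwise_stabilizer G \<phi> S = {\<one>\<^bsub>G\<^esub>}"
    using S by blast
next
  assume "\<exists>S. finite S \<and> S \<subseteq> E \<and> pointwise_stabilizer G \<phi> S = {\<one>\<^bsub>G\<^esub>}"
  then obtain S where S: "finite S" "S \<subseteq> E" "pointwise_stabilizer G \<phi> S = {\<one>\<^bsub>G\<^esub>}" by blast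
  have "g <#\<^bsub>G\<^esub> pointwise_stabilizer G \<phi> S \<subseteq> V" if "V \<subseteq> carrier G" "g \<in> V" for V g
    using that r_one[of g] S(3) by (auto simp: l_coset_def)
  then show "permutation_topology G E \<phi> = discrete_topology (carrier G)"
    unfolding topology_eq openin_permutation_topology openin_discrete_topology using S(1,2) by blast
qed

locale universal_building = coloured_building I M adj \<delta> Xs col
  for I :: "'i set" and M :: "'i \<Rightarrow> 'i \<Rightarrow> enat"
    and adj :: "'i \<Rightarrow> ('c \<times> 'c) set" and \<delta> :: "'c \<Rightarrow> 'c \<Rightarrow> 'i list set"
    and Xs :: "'i \<Rightarrow> 'x set" and col :: "'i \<Rightarrow> 'c \<Rightarrow> 'x" +
  fixes F :: "'i \<Rightarrow> ('x \<Rightarrow> 'x) set"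
  assumes F_subgroup: "k \<in> I \<Longrightarrow> subgroup (F k) (BijGroup (Xs k))"
begin

abbreviation U :: "('c \<Rightarrow> 'c) monoid" where
  "U \<equiv> universal_group I adj Xs col F"

abbreviation local_freeness :: bool where
  "local_freeness \<equiv>
     \<forall>i\<in>I. acts_freely ((BijGroup (Xs i))\<lparr>carrier := F i\<rparr>) (Xs i) (\<lambda>g. g)"

lemma F_Bij: "k \<in> I \<Longrightarrow> f \<in> F k \<Longrightarrow> f \<in> Bij (Xs k)"
  using subgroup.subset[OF F_subgroup[of k]] by (auto simp: BijGroup_def)

lemma F_id: "k \<in> I \<Longrightarrow> (\<lambda>x\<in>Xs k. x) \<in> F k"
  using subgroup.one_closed[OF F_subgroup[of k]] by (simp add: BijGroup_def)

lemma local_freeness_iff: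
  "local_freeness \<longleftrightarrow> (\<forall>i\<in>I. \<forall>f\<in>F i. \<forall>x\<in>Xs i. f x = x \<longrightarrow> f = (\<lambda>x\<in>Xs i. x))"
proof (rule ball_cong[OF HOL.refl])
  fix i assume i: "i \<in> I"
  show "acts_freely ((BijGroup (Xs i))\<lparr>carrier := F i\<rparr>) (Xs i) (\<lambda>g. g) \<longleftrightarrow>
    (\<forall>f\<in>F i. \<forall>x\<in>Xs i. f x = x \<longrightarrow> f = (\<lambda>x\<in>Xs i. x))"
    by (subst acts_freely_iff) (use F_id[OF i] in \<open>auto simp: BijGroup_def\<close>)
qed

lemma local_action_col:
  assumes "k \<in> I" "P \<in> panels adj k" "d \<in> P"
  shows "local_action Xs col g k P (col k d) = col k (g d)"
proof -
  have "bij_betw (col k) P (Xs k)" using legal assms unfolding legal_colouring_def by blast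
  then have "inv_into P (col k) (col k d) = d" using assms by (simp add: bij_betw_def)
  then show ?thesis using col_in[OF assms(1)] by (simp add: local_action_def)
qed

lemma local_action_eqI:
  assumes "k \<in> I" "P \<in> panels adj k" "f \<in> extensional (Xs k)"
    and "\<And>d. d \<in> P \<Longrightarrow> col k (g d) = f (col k d)"
  shows "local_action Xs col g k P = f"
proof (rule extensionalityI[of _ "Xs k"])
  fix x assume "x \<in> Xs k"
  moreover have "bij_betw (col k) P (Xs k)" using legal assms unfolding legal_colouring_def by blast
  ultimately obtain d where "d \<in> P" "x = col k d" by (auto simp: bij_betw_def)
  then show "local_action Xs col g k P x = f x" using local_action_col assms by simp
qed (use assms in \<open>auto simp: local_action_def\<close>)

lemma carrier_U: "carrier U = universal_set I adj Xs col F"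
  by (simp add: universal_group_def)

lemma one_U: "\<one>\<^bsub>U\<^esub> = id"
  by (auto simp: universal_group_def BijGroup_def)

lemma U_Bij: "g \<in> carrier U \<Longrightarrow> g \<in> Bij UNIV"
  by (simp add: carrier_U universal_set_def building_auts_def)

lemma mult_U: "\<lbrakk>g \<in> carrier U; h \<in> carrier U\<rbrakk> \<Longrightarrow> g \<otimes>\<^bsub>U\<^esub> h = g \<circ> h"
  using U_Bij[of g] U_Bij[of h]
  by (auto simp: universal_group_def BijGroup_def compose_def)

lemma id_in_U: "id \<in> carrier U"
proof -
  have "local_action Xs col id k P \<in> F k" if "k \<in> I" "P \<in> panels adj k" for k P
  proof -
    have "local_action Xs col id k P = (\<lambda>x\<in>Xs k. x)"
      by (rule local_action_eqI[OF that]) (use col_in[OF that(1)] in auto)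
    then show ?thesis using F_id that by simp
  qed
  then show ?thesis
    by (auto simp: carrier_U universal_set_def building_auts_def Bij_def)
qed

lemma U_free_iff:
  "acts_freely U UNIV (\<lambda>g. g) \<longleftrightarrow> (\<forall>g\<in>carrier U. \<forall>c. g c = c \<longrightarrow> g = id)"
  by (subst acts_freely_iff) (use id_in_U in \<open>auto simp: one_U\<close>)

lemma U_discrete_iff:
  "permutation_topology U UNIV (\<lambda>g. g) = discrete_topology (carrier U) \<longleftrightarrow>
    (\<exists>S. finite S \<and> pointwise_stabilizer U (\<lambda>g. g) S = {id})"
  by (subst permutation_topology_discrete_iff) (use id_in_U in \<open>auto simp: one_U mult_U\<close>)

text \<open>
  The automorphism acts by \<open>f\<close> on the \<open>i\<close>-panels inside \<open>A\<close> and trivially on all other panels. The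
  condition on the boundary of \<open>A\<close> is what makes the two prescriptions agree there.
\<close>

lemma exists_partial_twist:
  assumes i: "i \<in> I" and f: "f \<in> F i" "f x = x" and c: "col i c = x"
    and interior: "\<And>l d e. \<lbrakk>l \<in> I; l = i \<or> M i l = 2; (d, e) \<in> adj l\<rbrakk> \<Longrightarrow> d \<in> A \<longleftrightarrow> e \<in> A"
    and boundary: "\<And>l d e. \<lbrakk>l \<in> I; (d, e) \<in> adj l; d \<in> A; e \<notin> A\<rbrakk> \<Longrightarrow> col i d = x"
  shows "\<exists>g\<in>carrier U. g c = c \<and>
    (\<forall>k\<in>I. \<forall>d. col k (g d) = (if k = i \<and> d \<in> A then f (col k d) else col k d))"
proof -
  define \<psi> where "\<psi> k d = (if k = i \<and> d \<in> A then f else id)" for k d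
  have "\<exists>g\<in>building_auts I adj. g c = c \<and> (\<forall>k\<in>I. \<forall>d. col k (g d) = \<psi> k d (col k d))"
  proof (rule exists_automorphism_with_local_actions)
    show "bij_betw (\<psi> k d) (Xs k) (Xs k)" if "k \<in> I" for k d
      using F_Bij[OF i f(1)] by (auto simp: \<psi>_def Bij_def)
    show "\<psi> k d = \<psi> k e" if "k \<in> I" "l \<in> I" "l = k \<or> M k l = 2" "(d, e) \<in> adj l" for k l d e
      using interior[of l d e] that by (auto simp: \<psi>_def)
    show "\<psi> k d (col k d) = \<psi> k e (col k e)"
      if "k \<in> I" "l \<in> I" "k \<noteq> l" "(d, e) \<in> adj l" for k l d e
    proof -
      have "col k d = col k e" using col_const that by blast
      moreover have "(e, d) \<in> adj l" using symD[OF sym_adj] that by blast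
      ultimately show ?thesis
        using boundary[of l d e] boundary[of l e d] that f by (auto simp: \<psi>_def)
    qed
    show "col k c = \<psi> k c (col k c)" for k
      using c f by (auto simp: \<psi>_def)
  qed
  then obtain g where g: "g \<in> building_auts I adj" "g c = c"
    and cols: "\<And>k d. k \<in> I \<Longrightarrow> col k (g d) = \<psi> k d (col k d)" by blast
  have "local_action Xs col g k P \<in> F k" if k: "k \<in> I" and P: "P \<in> panels adj k" for k P
  proof -
    obtain d where d: "P = adj k `` {d}" using P by (auto simp: panels_def elim: quotientE)
    show ?thesis
    proof (cases "k = i \<and> d \<in> A")
      case True
      have "local_action Xs col g k P = f"
      proof (rule local_action_eqI[OF k P])
        show "f \<in> extensional (Xs k)" using F_Bij[OF i f(1)] True by (simp add: Bij_def)
        show "col k (g e) = f (col k e)" if "e \<in> P" for e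
          using interior[of k d e] True that d k cols by (auto simp: \<psi>_def)
      qed
      then show ?thesis using f True by simp
    next
      case False
      have "local_action Xs col g k P = (\<lambda>x\<in>Xs k. x)"
      proof (rule local_action_eqI[OF k P])
        show "col k (g e) = (\<lambda>x\<in>Xs k. x) (col k e)" if "e \<in> P" for e
          using interior[of k d e] False that d k cols[OF k, of e] col_in[OF k]
          by (auto simp: \<psi>_def split: if_splits)
      qed simp
      then show ?thesis using F_id k by simp
    qed
  qed
  then have "g \<in> carrier U" using g by (simp add: carrier_U universal_set_def)
  then show ?thesis using g cols unfolding \<psi>_def by (intro bexI[of _ g]) auto
qed

lemma U_free_if_locally_free:
  assumes local_freeness
  shows "acts_freely U UNIV (\<lambda>g. g)"
  unfolding U_free_iff
proof (intro ballI allI impI)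
  fix g c assume g: "g \<in> carrier U" and c: "g c = c"
  have aut: "g \<in> building_auts I adj" using g by (simp add: carrier_U universal_set_def)
  have step: "g e = e" if d: "g d = d" and k: "k \<in> I" and de: "(d, e) \<in> adj k" for d e k
  proof -
    let ?P = "adj k `` {d}" and ?\<sigma> = "local_action Xs col g k (adj k `` {d})"
    have P: "?P \<in> panels adj k" "d \<in> ?P" "e \<in> ?P" using panel_of adj_refl k de by auto
    have "?\<sigma> \<in> F k" using g P k by (auto simp: carrier_U universal_set_def)
    moreover have "?\<sigma> (col k d) = col k d" using local_action_col[OF k P(1,2)] d by simp
    ultimately have "?\<sigma> = (\<lambda>x\<in>Xs k. x)" using assms local_freeness_iff col_in k by blast
    then have "col k (g e) = col k e" using local_action_col[OF k P(1,3), of g] col_in[OF k] by simp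
    then show ?thesis using automorphism_fixes_neighbour[OF aut k de d] by blast
  qed
  have "g d = d" if "w \<in> lists I" "gallery adj a w d" "g a = a" for w a d
    using that
  proof (induction w arbitrary: a)
    case (Cons k w)
    then obtain b where "(a, b) \<in> adj k" "gallery adj b w d" by auto
    then show ?case using step[OF Cons.prems(2), of k b] Cons.hyps Cons.IH by blast
  qed simp
  then have "g d = d" for d using connected[of c d] c by blast
  then show "g = id" by auto
qed

text \<open>
  The twist by \<open>f\<close> of all \<open>i\<close>-colours fixes a chamber, so it is trivial, and then so is \<open>f\<close>.
\<close>

lemma locally_free_if_U_free:
  assumes "acts_freely U UNIV (\<lambda>g. g)"
  shows local_freeness
  unfolding local_freeness_iff
proof (intro ballI impI)
  fix i f x assume h: "i \<in> I" "f \<in> F i" "x \<in> Xs i" "f x = x"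
  obtain c where c: "col i c = x" using col_surj h by blast
  obtain g where g: "g \<in> carrier U" "g c = c" "\<And>d. col i (g d) = f (col i d)"
    using exists_partial_twist[OF h(1,2,4) c, of UNIV] h(1) by auto
  have id: "g = id" using assms U_free_iff g by blast
  show "f = (\<lambda>x\<in>Xs i. x)"
  proof (rule extensionalityI[of _ "Xs i"])
    show "f \<in> extensional (Xs i)" using F_Bij h by (simp add: Bij_def)
    fix y assume y: "y \<in> Xs i"
    then obtain d where "col i d = y" using col_surj h by blast
    then show "f y = (\<lambda>x\<in>Xs i. x) y" using g(3)[of d] id y by simp
  qed simp
qed

lemma U_discrete_if_free:
  assumes "acts_freely U UNIV (\<lambda>g. g)"
  shows "permutation_topology U UNIV (\<lambda>g. g) = discrete_topology (carrier U)"
  unfolding U_discrete_iff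
proof (intro exI conjI)
  show "pointwise_stabilizer U (\<lambda>g. g) {c} = {id}" for c
    using assms id_in_U unfolding U_free_iff pointwise_stabilizer_def by auto
qed simp

text \<open>
  Discreteness gives a finite set \<open>S\<close> with trivial pointwise stabiliser. The twist by \<open>f\<close> outside a region
  \<open>beyond j c\<close> that contains \<open>S\<close> fixes \<open>S\<close>, so it is trivial; but it acts as \<open>f\<close> on the \<open>i\<close>-panel of \<open>c\<close>,
  which lies outside the region.
\<close>

lemma locally_free_if_U_discrete:
  assumes "no_isolated_node I M"
    and "permutation_topology U UNIV (\<lambda>g. g) = discrete_topology (carrier U)"
  shows local_freeness
  unfolding local_freeness_iff
proof (intro ballI impI)
  fix i f x assume h: "i \<in> I" "f \<in> F i" "x \<in> Xs i" "f x = x"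
  obtain j where j: "j \<in> I" "M i j = \<infinity>" using assms(1) h(1) unfolding no_isolated_node_def by blast
  have ij: "i \<noteq> j" "M i j \<noteq> 2" "M j i \<noteq> 2"
    using j h(1) diagonal[of i] symmetric[of i j] by (auto simp: numeral_eq_enat one_enat_def)
  obtain S where S: "finite S" "pointwise_stabilizer U (\<lambda>g. g) S = {id}"
    using assms(2) U_discrete_iff by blast
  obtain c where c: "col i c = x" "S \<subseteq> beyond j c"
    using finite_set_beyond[OF h(1) j(1) ij(1,2) h(3) S(1)] by blast
  have "\<exists>g\<in>carrier U. g c = c \<and>
    (\<forall>k\<in>I. \<forall>d. col k (g d) = (if k = i \<and> d \<in> - beyond j c then f (col k d) else col k d))"
  proof (rule exists_partial_twist[OF h(1,2,4) c(1)])
    fix l d e assume l: "l \<in> I" "l = i \<or> M i l = 2" "(d, e) \<in> adj l"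
    then have "l \<noteq> j" "(e, d) \<in> adj l" using ij symD[OF sym_adj] by auto
    then show "d \<in> - beyond j c \<longleftrightarrow> e \<in> - beyond j c"
      using beyond_closed[OF j(1) l(1)] l(3) by blast
  next
    fix l d e assume l: "l \<in> I" "(d, e) \<in> adj l" "d \<in> - beyond j c" "e \<notin> - beyond j c"
    then have "l = j" using beyond_closed[OF j(1) l(1), of e d c] symD[OF sym_adj[OF l(1)]] by blast
    then show "col i d = x" using beyond_boundary[OF j(1), of d e c i] l h(1) ij c(1) by auto
  qed
  then obtain g where g: "g \<in> carrier U" "g c = c"
    "\<And>k d. k \<in> I \<Longrightarrow> col k (g d) = (if k = i \<and> d \<notin> beyond j c then f (col k d) else col k d)"
    by auto
  have "g \<in> building_auts I adj" using g(1) by (simp add: carrier_U universal_set_def)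
  then have "g s = s" if "s \<in> S" for s
    using automorphism_fixes_beyond[of g c j s] g(2,3) j(1) c(2) that by auto
  then have "g \<in> pointwise_stabilizer U (\<lambda>g. g) S" using g(1) by (simp add: pointwise_stabilizer_def)
  then have id: "g = id" using S(2) by simp
  show "f = (\<lambda>x\<in>Xs i. x)"
  proof (rule extensionalityI[of _ "Xs i"])
    show "f \<in> extensional (Xs i)" using F_Bij h by (simp add: Bij_def)
    fix y assume y: "y \<in> Xs i"
    then obtain d where d: "(c, d) \<in> adj i" "col i d = y" using col_surj h by blast
    have "d \<notin> beyond j c"
      using beyond_closed[OF j(1) h(1) ij(1), of d c c] not_beyond_self[OF j(1)]
        symD[OF sym_adj[OF h(1)] d(1)] by blast
    then show "f y = (\<lambda>x\<in>Xs i. x) y" using g(3)[OF h(1), of d] id y d by simp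
  qed simp
qed

end

theorem proposition3p14:
  fixes I :: "'i set" and M :: "'i \<Rightarrow> 'i \<Rightarrow> enat"
    and adj :: "'i \<Rightarrow> ('c \<times> 'c) set" and \<delta> :: "'c \<Rightarrow> 'c \<Rightarrow> 'i list set"
    and Xs :: "'i \<Rightarrow> 'x set" and F :: "'i \<Rightarrow> ('x \<Rightarrow> 'x) set"
    and col :: "'i \<Rightarrow> 'c \<Rightarrow> 'x"
  assumes "right_angled_building I M adj \<delta>"
    and "\<forall>i\<in>I. \<exists>x\<in>Xs i. \<exists>y\<in>Xs i. x \<noteq> y"
    and "\<forall>i\<in>I. subgroup (F i) (BijGroup (Xs i))"
    and "semiregular I adj Xs"
    and "legal_colouring I adj Xs col"
  shows
    "((\<forall>i\<in>I. acts_freely ((BijGroup (Xs i))\<lparr>carrier := F i\<rparr>) (Xs i) (\<lambda>g. g)) \<longleftrightarrow>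
        acts_freely (universal_group I adj Xs col F) UNIV (\<lambda>g. g)) \<and>
     (acts_freely (universal_group I adj Xs col F) UNIV (\<lambda>g. g) \<longrightarrow>
        permutation_topology (universal_group I adj Xs col F) UNIV (\<lambda>g. g) =
          discrete_topology (carrier (universal_group I adj Xs col F))) \<and>
     (no_isolated_node I M \<longrightarrow>
        permutation_topology (universal_group I adj Xs col F) UNIV (\<lambda>g. g) =
          discrete_topology (carrier (universal_group I adj Xs col F)) \<longrightarrow>
        (\<forall>i\<in>I. acts_freely ((BijGroup (Xs i))\<lparr>carrier := F i\<rparr>) (Xs i) (\<lambda>g. g)))"
proof -
  interpret universal_building I M adj \<delta> Xs col F
    using assms
    by (intro universal_building.intro coloured_building.intro coloured_building_axioms.intro
        universal_building_axioms.intro) auto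
  show ?thesis
    using U_free_if_locally_free locally_free_if_U_free U_discrete_if_free
      locally_free_if_U_discrete by blast
qed

end
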